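(* Let $R$ be a connected reduced order with universal grading $(\Gamma,(R_\gamma)_{\gamma\in\Gamma})$ and degree map $d\colon\mu\to\Gamma$. The map $\operatorname{Id}_0(d)\to\mathcal{D}(R)$ given by $f\mapsto\big(\bigoplus_{\gamma\in\ker(f)}R_\gamma,\ \operatorname{im}(f)\big)$ is well defined and is an isomorphism of partially ordered sets that respects the actions of $\operatorname{Aut}(R)$. Its inverse sends $(A,G)\in\mathcal{D}(R)$ to the homomorphism $f\colon\Gamma\to\mu$ determined as follows: $\Gamma=\Gamma_A\times d(G)$ where $\Gamma_A$ is the subgroup generated by $\{\gamma: R_\gamma\cap A\ne0\}$, $d$ restricts to an isomorphism $G\to d(G)$, and $f$ is trivial on $\Gamma_A$ and equals the inverse of this isomorphism on $d(G)$.
   Context: All rings have a unit element. An order is a commutative ring whose additive group is isomorphic to $\mathbb{Z}^n$; reduced means no non-zero nilpotents, connected means exactly two idempotents. $\mu=\mu(R)$ is the group of roots of unity. A grading of $R$ is a pair $(\Delta,(R_\delta)_\delta)$ with $\Delta$ an abelian group and $R_\delta$ additive subgroups such that $R_\gamma R_\delta\subset R_{\gamma\delta}$ and $\bigoplus_\delta R_\delta\to R$ is bijective; it is universal if every grading of $R$ is the pushforward $(E,(\sum_{\delta\in f^{-1}\epsilon}R_\delta)_\epsilon)$ along a unique homomorphism $f$ from its group. Every reduced order has a universal grading with finite group; for connected reduced $R$ every $\zeta\in\mu$ lies in $R_\gamma$ for a unique $\gamma$, and the degree map $d\colon\mu\to\Gamma$, $\zeta\mapsto\gamma$, is a homomorphism.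 $\operatorname{Id}_0(d)=\{f\in\operatorname{Hom}(\Gamma,\mu): f\circ d\circ f=f\}$, partially ordered by $f\leq g$ iff $f\circ d\circ g=g\circ d\circ f=f$. $\mathcal{D}(R)$ is the set of pairs $(A,G)$ with $A\subset R$ a subring and $G\subset R^*$ a subgroup such that the natural map from the group ring $A[G]$ to $R$ is an isomorphism, partially ordered by $(B,H)\leq(A,G)$ iff $H\subset G$ and $B\supset A$. $\operatorname{Aut}(R)$ acts on $\mathcal{D}(R)$ componentwise; each $\sigma\in\operatorname{Aut}(R)$ induces $\sigma_\Gamma\in\operatorname{Aut}(\Gamma)$ with $\sigma(R_\gamma)=R_{\sigma_\Gamma(\gamma)}$, and $\sigma$ acts on $\operatorname{Id}_0(d)$ by $f\mapsto\sigma|_\mu\circ f\circ\sigma_\Gamma^{-1}$. *)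

theory Defs
  imports "HOL-Algebra.Algebra"
begin

definition is_order :: "'r::comm_ring_1 itself \<Rightarrow> bool" where
  "is_order _ \<longleftrightarrow> (\<exists>(n::nat) (b::nat \<Rightarrow> 'r). \<forall>r::'r. \<exists>!c::nat \<Rightarrow> int.
      (\<forall>i\<ge>n. c i = 0) \<and> r = (\<Sum>i<n. of_int (c i) * b i))"

definition is_reduced :: "'r::comm_ring_1 itself \<Rightarrow> bool" where
  "is_reduced _ \<longleftrightarrow> (\<forall>(x::'r) (k::nat). x ^ k = 0 \<longrightarrow> x = 0)"

definition is_connected :: "'r::comm_ring_1 itself \<Rightarrow> bool" where
  "is_connected _ \<longleftrightarrow> card {e::'r. e * e = e} = 2"

definition roots_of_unity :: "'r::comm_ring_1 set" where
  "roots_of_unity = {x. \<exists>k::nat. k > 0 \<and> x ^ k = 1}"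

definition graded_span :: "('g \<Rightarrow> 'r::comm_ring_1 set) \<Rightarrow> 'g set \<Rightarrow> 'r set" where
  "graded_span Rd K = {r. \<exists>S x. finite S \<and> S \<subseteq> K \<and> (\<forall>g\<in>S. x g \<in> Rd g) \<and> r = (\<Sum>g\<in>S. x g)}"

definition is_grading :: "('g, 'b) monoid_scheme \<Rightarrow> ('g \<Rightarrow> 'r::comm_ring_1 set) \<Rightarrow> bool" where
  "is_grading D Rd \<longleftrightarrow> comm_group D
    \<and> (\<forall>d\<in>carrier D. 0 \<in> Rd d \<and> (\<forall>x\<in>Rd d. \<forall>y\<in>Rd d. x - y \<in> Rd d))
    \<and> (\<forall>c\<in>carrier D. \<forall>d\<in>carrier D. \<forall>x\<in>Rd c. \<forall>y\<in>Rd d. x * y \<in> Rd (c \<otimes>\<^bsub>D\<^esub> d))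
    \<and> (\<forall>r. \<exists>!x. x \<in> extensional (carrier D) \<and> (\<forall>d\<in>carrier D. x d \<in> Rd d)
           \<and> finite {d\<in>carrier D. x d \<noteq> 0} \<and> r = (\<Sum>d\<in>{d\<in>carrier D. x d \<noteq> 0}. x d))"

definition universal_grading :: "'g monoid \<Rightarrow> ('g \<Rightarrow> 'r::comm_ring_1 set) \<Rightarrow> bool" where
  "universal_grading G Rd \<longleftrightarrow> is_grading G Rd \<and>
     (\<forall>(E::nat monoid) (Re::nat \<Rightarrow> 'r set). is_grading E Re \<longrightarrow>
        (\<exists>!f. f \<in> hom G E \<and> f \<in> extensional (carrier G) \<and>
              (\<forall>e\<in>carrier E. Re e = graded_span Rd {g\<in>carrier G. f g = e})))"

definition deg :: "'g monoid \<Rightarrow> ('g \<Rightarrow> 'r::comm_ring_1 set) \<Rightarrow> 'r \<Rightarrow> 'g" where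
  "deg G Rd z = (THE g. g \<in> carrier G \<and> z \<in> Rd g)"

definition Id0 :: "'g monoid \<Rightarrow> ('g \<Rightarrow> 'r::comm_ring_1 set) \<Rightarrow> ('g \<Rightarrow> 'r) set" where
  "Id0 G Rd = {f. f \<in> carrier G \<rightarrow>\<^sub>E roots_of_unity
      \<and> (\<forall>a\<in>carrier G. \<forall>b\<in>carrier G. f (a \<otimes>\<^bsub>G\<^esub> b) = f a * f b)
      \<and> (\<forall>g\<in>carrier G. f (deg G Rd (f g)) = f g)}"

definition Id0_le :: "'g monoid \<Rightarrow> ('g \<Rightarrow> 'r::comm_ring_1 set) \<Rightarrow> ('g \<Rightarrow> 'r) \<Rightarrow> ('g \<Rightarrow> 'r) \<Rightarrow> bool" where
  "Id0_le G Rd f h \<longleftrightarrow> (\<forall>g\<in>carrier G. f (deg G Rd (h g)) = f g \<and> h (deg G Rd (f g)) = f g)"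

definition is_subring :: "'r::comm_ring_1 set \<Rightarrow> bool" where
  "is_subring A \<longleftrightarrow> 1 \<in> A \<and> (\<forall>x\<in>A. \<forall>y\<in>A. x + y \<in> A \<and> x - y \<in> A \<and> x * y \<in> A)"

definition is_unit_subgroup :: "'r::comm_ring_1 set \<Rightarrow> bool" where
  "is_unit_subgroup H \<longleftrightarrow> 1 \<in> H \<and> (\<forall>x\<in>H. \<forall>y\<in>H. x * y \<in> H) \<and> (\<forall>x\<in>H. \<exists>y\<in>H. x * y = 1)"

text \<open>The natural map A[G] -> R (finitely supported a : G -> A maps to sum a(g) g) is bijective.\<close>
definition group_ring_iso :: "'r::comm_ring_1 set \<Rightarrow> 'r set \<Rightarrow> bool" where
  "group_ring_iso A H \<longleftrightarrow> (\<forall>r. \<exists>!a. a \<in> H \<rightarrow>\<^sub>E A \<and> finite {g\<in>H. a g \<noteq> 0}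
        \<and> r = (\<Sum>g\<in>{g\<in>H. a g \<noteq> 0}. a g * g))"

definition DR :: "'r::comm_ring_1 itself \<Rightarrow> ('r set \<times> 'r set) set" where
  "DR _ = {(A, H). is_subring A \<and> is_unit_subgroup H \<and> group_ring_iso A H}"

definition DR_le :: "'r set \<times> 'r set \<Rightarrow> 'r set \<times> 'r set \<Rightarrow> bool" where
  "DR_le p q \<longleftrightarrow> snd p \<subseteq> snd q \<and> fst q \<subseteq> fst p"

definition Phi :: "'g monoid \<Rightarrow> ('g \<Rightarrow> 'r::comm_ring_1 set) \<Rightarrow> ('g \<Rightarrow> 'r) \<Rightarrow> 'r set \<times> 'r set" where
  "Phi G Rd f = (graded_span Rd {g\<in>carrier G. f g = 1}, f ` carrier G)"

definition ring_aut :: "('r::comm_ring_1 \<Rightarrow> 'r) \<Rightarrow> bool" where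
  "ring_aut s \<longleftrightarrow> bij s \<and> s 1 = 1 \<and> (\<forall>x y. s (x + y) = s x + s y \<and> s (x * y) = s x * s y)"

definition induced_aut :: "'g monoid \<Rightarrow> ('g \<Rightarrow> 'r::comm_ring_1 set) \<Rightarrow> ('r \<Rightarrow> 'r) \<Rightarrow> ('g \<Rightarrow> 'g) \<Rightarrow> bool" where
  "induced_aut G Rd s h \<longleftrightarrow> h \<in> iso G G \<and> (\<forall>g\<in>carrier G. s ` Rd g = Rd (h g))"

definition act_Id0 :: "'g monoid \<Rightarrow> ('r \<Rightarrow> 'r) \<Rightarrow> ('g \<Rightarrow> 'g) \<Rightarrow> ('g \<Rightarrow> 'r) \<Rightarrow> ('g \<Rightarrow> 'r)" where
  "act_Id0 G s h f = (\<lambda>g\<in>carrier G. s (f (inv_into (carrier G) h g)))"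

definition act_DR :: "('r \<Rightarrow> 'r) \<Rightarrow> 'r set \<times> 'r set \<Rightarrow> 'r set \<times> 'r set" where
  "act_DR s p = (s ` fst p, s ` snd p)"

definition GammaA :: "'g monoid \<Rightarrow> ('g \<Rightarrow> 'r::comm_ring_1 set) \<Rightarrow> 'r set \<Rightarrow> 'g set" where
  "GammaA G Rd A = generate G {g\<in>carrier G. \<exists>x\<in>Rd g \<inter> A. x \<noteq> 0}"

end

theory Submission
  imports Defs Complex_Main "HOL-Library.Countable_Set"
begin

text \<open>The key fact is that every root of unity \<open>\<zeta>\<close> of \<open>R\<close> is homogeneous. Characters of the
  grading group with values in the complex roots of unity separate its elements, so it suffices to
  treat gradings by complex roots of unity. There the maps \<open>r \<mapsto> \<Sum>\<^sub>w w\<^sup>a r\<^sub>w\<close> act on \<open>R \<otimes> \<complex>\<close> and send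
  \<open>\<zeta>\<close> to elements of finite order, which together generate a finite group; every component of
  \<open>\<zeta>\<close> is an average of such elements times scalars of absolute value 1. Hence its powers are
  bounded, so they take finitely many values in the lattice \<open>R\<close>, so some power is an idempotent and
  the component is 0 or a unit of finite order. Dividing by a nonzero component one may assume that
  \<open>\<zeta>\<^sub>1 = 1\<close>; then 1 is an average of elements of a finite group, which forces \<open>\<zeta> = 1\<close>.

  Given \<open>f\<close> in \<open>Id0\<close>, multiplication by a root of unity \<open>z\<close> in the image of \<open>f\<close> maps the span of the
  kernel onto the span of the fibre over \<open>z\<close>, so the pushforward of the grading along \<open>f\<close> is a group
  ring decomposition. Conversely such a decomposition is a grading, and universality produces \<open>f\<close>.\<close>

section \<open>Components and pushforwards of gradings\<close>

text \<open>The degree group is treated as an arbitrary abelian group, so its characters have to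
  come from Zorn's lemma. The space R \<otimes> C is replaced by its dual, the additive maps from R
  to C: what the overview calls a finite group shows up only as a finite set of functionals stable
  under twisting.

  An obstacle shapes the last section. R sees only those degrees in which it has a nonzero element,
  whereas members of \<open>Id0\<close> are homomorphisms on the whole group. Equality at the other
  degrees can come only from the uniqueness clause of universality, on which injectivity, the
  reflection of the order and the generation of the group by the degrees that occur all rest.
  Conversely, the group H of a decomposition is not given as torsion; it is finite because any
  grading of an order has only finitely many degrees with a nonzero piece, and finiteness makes its
  members roots of unity.\<close>

locale graded_ring = comm_group D for D :: "('g, 'b) monoid_scheme" (structure) +
  fixes Rd :: "'g \<Rightarrow> 'r::comm_ring_1 set"
  assumes grading: "is_grading D Rd"
begin

lemma Rd_zero: "d \<in> carrier D \<Longrightarrow> 0 \<in> Rd d"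
  using grading unfolding is_grading_def by blast

lemma Rd_diff: "d \<in> carrier D \<Longrightarrow> x \<in> Rd d \<Longrightarrow> y \<in> Rd d \<Longrightarrow> x - y \<in> Rd d"
  using grading unfolding is_grading_def by blast

lemma Rd_mult:
  "c \<in> carrier D \<Longrightarrow> d \<in> carrier D \<Longrightarrow> x \<in> Rd c \<Longrightarrow> y \<in> Rd d \<Longrightarrow> x * y \<in> Rd (c \<otimes> d)"
  using grading unfolding is_grading_def by blast

lemma Rd_add: "d \<in> carrier D \<Longrightarrow> x \<in> Rd d \<Longrightarrow> y \<in> Rd d \<Longrightarrow> x + y \<in> Rd d"
  using Rd_diff[of d x "0 - y"] Rd_diff[of d 0 y] Rd_zero by simp

definition cmp :: "'r \<Rightarrow> 'g \<Rightarrow> 'r" where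
  "cmp r = (THE x. x \<in> extensional (carrier D) \<and> (\<forall>d\<in>carrier D. x d \<in> Rd d)
     \<and> finite {d\<in>carrier D. x d \<noteq> 0} \<and> r = (\<Sum>d\<in>{d\<in>carrier D. x d \<noteq> 0}. x d))"

definition supp :: "'r \<Rightarrow> 'g set" where
  "supp r = {d\<in>carrier D. cmp r d \<noteq> 0}"

lemma decomposition_ex1:
  "\<exists>!x. x \<in> extensional (carrier D) \<and> (\<forall>d\<in>carrier D. x d \<in> Rd d)
     \<and> finite {d\<in>carrier D. x d \<noteq> 0} \<and> r = (\<Sum>d\<in>{d\<in>carrier D. x d \<noteq> 0}. x d)"
  using grading unfolding is_grading_def by blast

lemma cmp_in: "d \<in> carrier D \<Longrightarrow> cmp r d \<in> Rd d"
  and finite_supp: "finite (supp r)"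
  and sum_cmp: "(\<Sum>d\<in>supp r. cmp r d) = r"
  using theI'[OF decomposition_ex1[of r]] unfolding cmp_def[symmetric] supp_def by auto

lemma supp_carrier: "supp r \<subseteq> carrier D"
  by (auto simp: supp_def)

lemma sum_cmp_superset:
  assumes "finite S" "supp r \<subseteq> S" "S \<subseteq> carrier D"
  shows "(\<Sum>d\<in>S. cmp r d) = r"
proof -
  have "(\<Sum>d\<in>S. cmp r d) = (\<Sum>d\<in>supp r. cmp r d)"
    using assms by (intro sum.mono_neutral_right) (auto simp: supp_def)
  then show ?thesis by (simp add: sum_cmp)
qed

text \<open>The family \<open>x\<close> may vanish on part of \<open>S\<close> and is unconstrained
  off \<open>S\<close>, unlike the normalised families of \<open>is_grading\<close>; cutting it down
  and extending it by 0 leads back to one of those. Most computations of components go through this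
  form.\<close>

lemma cmp_unique:
  assumes "finite S" "S \<subseteq> carrier D" "\<And>d. d \<in> S \<Longrightarrow> x d \<in> Rd d" "r = (\<Sum>d\<in>S. x d)"
    and d: "d \<in> carrier D"
  shows "cmp r d = (if d \<in> S then x d else 0)"
proof -
  let ?P = "\<lambda>x. x \<in> extensional (carrier D) \<and> (\<forall>d\<in>carrier D. x d \<in> Rd d)
     \<and> finite {d\<in>carrier D. x d \<noteq> 0} \<and> r = (\<Sum>d\<in>{d\<in>carrier D. x d \<noteq> 0}. x d)"
  let ?y = "\<lambda>d\<in>carrier D. if d \<in> S then x d else 0"
  have eq: "{d\<in>carrier D. ?y d \<noteq> 0} = {d\<in>S. x d \<noteq> 0}"
    using assms(2) by auto
  have "r = (\<Sum>d\<in>{d\<in>S. x d \<noteq> 0}. x d)"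
    unfolding assms(4) using assms(1) by (intro sum.mono_neutral_right) auto
  also have "\<dots> = (\<Sum>d\<in>{d\<in>carrier D. ?y d \<noteq> 0}. ?y d)"
    unfolding eq using assms(2) by (intro sum.cong) auto
  finally have r: "r = (\<Sum>d\<in>{d\<in>carrier D. ?y d \<noteq> 0}. ?y d)" .
  have "?P ?y"
    using assms(1,3) by (intro conjI ballI r; simp add: eq Rd_zero)
  then have "cmp r = ?y"
    unfolding cmp_def using decomposition_ex1[of r] by (intro the1_equality) auto
  then show ?thesis using d by simp
qed

lemma cmp_homogeneous:
  assumes "d \<in> carrier D" "r \<in> Rd d" "e \<in> carrier D"
  shows "cmp r e = (if e = d then r else 0)"
  using cmp_unique[of "{d}" "\<lambda>_. r" r e] assms by auto

lemma cmp_zero: "d \<in> carrier D \<Longrightarrow> cmp 0 d = 0"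
  using cmp_unique[of "{}" "\<lambda>_. 0" 0 d] by simp

lemma cmp_add:
  assumes "d \<in> carrier D"
  shows "cmp (x + y) d = cmp x d + cmp y d"
proof -
  let ?S = "supp x \<union> supp y"
  have "x + y = (\<Sum>d\<in>?S. cmp x d) + (\<Sum>d\<in>?S. cmp y d)"
    using sum_cmp_superset[of ?S x] sum_cmp_superset[of ?S y] finite_supp supp_carrier by simp
  also have "\<dots> = (\<Sum>d\<in>?S. cmp x d + cmp y d)"
    by (simp add: sum.distrib)
  finally have "cmp (x + y) d = (if d \<in> ?S then cmp x d + cmp y d else 0)"
    using finite_supp supp_carrier assms
    by (intro cmp_unique[of ?S "\<lambda>d. cmp x d + cmp y d"]) (auto intro!: Rd_add cmp_in)
  then show ?thesis using assms by (auto simp: supp_def)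
qed

lemma cmp_sum: "d \<in> carrier D \<Longrightarrow> cmp (\<Sum>i\<in>I. x i) d = (\<Sum>i\<in>I. cmp (x i) d)"
  by (induction I rule: infinite_finite_induct) (auto simp: cmp_zero cmp_add)

lemma cmp_eqI: 
  assumes "\<And>d. d \<in> carrier D \<Longrightarrow> cmp x d = cmp y d"
  shows "x = y"
proof -
  have "supp x = supp y" using assms by (auto simp: supp_def)
  then have "(\<Sum>d\<in>supp x. cmp x d) = (\<Sum>d\<in>supp y. cmp y d)"
    using assms by (intro sum.cong) (auto simp: supp_def)
  then show ?thesis by (simp add: sum_cmp)
qed

text \<open>Translation by \<open>d\<close> is injective on the group, so multiplying the components
  of \<open>x\<close> by \<open>y\<close> moves them to distinct degrees and no two of them
  merge.\<close>

lemma cmp_mult_homogeneous: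
  assumes "d \<in> carrier D" "y \<in> Rd d" "t \<in> carrier D"
  shows "cmp (x * y) (t \<otimes> d) = cmp x t * y"
proof -
  have "x * y = (\<Sum>e\<in>supp x. cmp x e * y)"
    by (simp add: sum_distrib_right[symmetric] sum_cmp)
  then have "cmp (x * y) (t \<otimes> d) = (\<Sum>e\<in>supp x. cmp (cmp x e * y) (t \<otimes> d))"
    using assms by (simp add: cmp_sum)
  also have "\<dots> = (\<Sum>e\<in>supp x. if e = t then cmp x e * y else 0)"
  proof (intro sum.cong refl)
    fix e assume "e \<in> supp x"
    then have e: "e \<in> carrier D" using supp_carrier by blast
    have "cmp (cmp x e * y) (t \<otimes> d) = (if t \<otimes> d = e \<otimes> d then cmp x e * y else 0)"
      using assms e by (intro cmp_homogeneous Rd_mult cmp_in) auto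
    then show "cmp (cmp x e * y) (t \<otimes> d) = (if e = t then cmp x e * y else 0)"
      using assms e by auto
  qed
  also have "\<dots> = cmp x t * y"
    using assms finite_supp by (auto simp: supp_def)
  finally show ?thesis .
qed

text \<open>That 1 has degree \<one> is not built into \<open>is_grading\<close>. Comparing
  components of degree \<open>t\<close> in 1 * x = x for \<open>x\<close> homogeneous of degree
  \<open>t\<close> shows that \<open>cmp 1 \<one>\<close> acts as the identity on homogeneous
  elements, hence on 1.\<close>

lemma one_in: "1 \<in> Rd \<one>"
proof -
  have *: "cmp x t * cmp 1 \<one> = cmp x t" if "t \<in> carrier D" for x t
    using cmp_mult_homogeneous[of t "cmp x t" \<one> 1] cmp_homogeneous[of t "cmp x t" t] that
    by (simp add: cmp_in mult.commute)
  have "1 * cmp 1 \<one> = (1 :: 'r)"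
  proof -
    have "1 * cmp 1 \<one> = (\<Sum>t\<in>supp 1. cmp 1 t * cmp 1 \<one>)"
      by (simp add: sum_distrib_right[symmetric] sum_cmp)
    also have "\<dots> = (\<Sum>t\<in>supp 1. cmp 1 t)"
      using supp_carrier * by (intro sum.cong) auto
    finally show ?thesis by (simp only: sum_cmp)
  qed
  then show ?thesis using cmp_in[of \<one> 1] by simp
qed

lemma degree_unique:
  assumes "c \<in> carrier D" "d \<in> carrier D" "x \<in> Rd c" "x \<in> Rd d" "x \<noteq> 0"
  shows "c = d"
  using cmp_homogeneous[of c x d] cmp_homogeneous[of d x d] assms by (auto split: if_splits)

lemma graded_span_iff:
  assumes "K \<subseteq> carrier D"
  shows "r \<in> graded_span Rd K \<longleftrightarrow> supp r \<subseteq> K"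
proof
  assume "r \<in> graded_span Rd K"
  then obtain S x where S: "finite S" "S \<subseteq> K" "\<forall>g\<in>S. x g \<in> Rd g" "r = (\<Sum>g\<in>S. x g)"
    unfolding graded_span_def by blast
  then show "supp r \<subseteq> K"
    using cmp_unique[of S x r] assms by (auto simp: supp_def split: if_splits)
next
  assume "supp r \<subseteq> K"
  then show "r \<in> graded_span Rd K"
    unfolding graded_span_def using finite_supp[of r] sum_cmp[of r] cmp_in[of _ r] assms
    by (intro CollectI exI[of _ "supp r"] exI[of _ "cmp r"]) auto
qed

section \<open>Coarsening a grading along a homomorphism of degree groups\<close>

lemma pushforward_mult:
  assumes "comm_group E" and f: "f \<in> hom D E" and a: "a \<in> carrier E" "b \<in> carrier E"
    and x: "x \<in> graded_span Rd {g\<in>carrier D. f g = a}"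
    and y: "y \<in> graded_span Rd {g\<in>carrier D. f g = b}"
  shows "x * y \<in> graded_span Rd {g\<in>carrier D. f g = a \<otimes>\<^bsub>E\<^esub> b}"
proof -
  have sx: "supp x \<subseteq> {g\<in>carrier D. f g = a}" and sy: "supp y \<subseteq> {g\<in>carrier D. f g = b}"
    using x y by (simp_all add: graded_span_iff)
  have "x * y = (\<Sum>c\<in>supp x. cmp x c) * (\<Sum>d\<in>supp y. cmp y d)"
    by (simp add: sum_cmp)
  also have "\<dots> = (\<Sum>c\<in>supp x. \<Sum>d\<in>supp y. cmp x c * cmp y d)"
    by (simp add: sum_product)
  finally have eq: "x * y = (\<Sum>c\<in>supp x. \<Sum>d\<in>supp y. cmp x c * cmp y d)" .
  have "g \<in> {g\<in>carrier D. f g = a \<otimes>\<^bsub>E\<^esub> b}" if "g \<in> supp (x * y)" for g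
  proof -
    have g: "g \<in> carrier D" "cmp (x * y) g \<noteq> 0" using that by (auto simp: supp_def)
    have "cmp (x * y) g = (\<Sum>c\<in>supp x. \<Sum>d\<in>supp y. cmp (cmp x c * cmp y d) g)"
      unfolding eq using g(1) by (simp only: cmp_sum)
    with g(2) have "(\<Sum>c\<in>supp x. \<Sum>d\<in>supp y. cmp (cmp x c * cmp y d) g) \<noteq> 0" by simp
    then obtain c where "c \<in> supp x" "(\<Sum>d\<in>supp y. cmp (cmp x c * cmp y d) g) \<noteq> 0"
      by (rule sum.not_neutral_contains_not_neutral)
    moreover from this(2) obtain d where "d \<in> supp y" "cmp (cmp x c * cmp y d) g \<noteq> 0"
      by (rule sum.not_neutral_contains_not_neutral)
    ultimately have cd: "c \<in> supp x" "d \<in> supp y" "cmp (cmp x c * cmp y d) g \<noteq> 0"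
      by simp_all
    then have c: "c \<in> carrier D" "f c = a" and d: "d \<in> carrier D" "f d = b"
      using sx sy by auto
    have "g = c \<otimes> d"
      using cd(3) c d cmp_homogeneous[of "c \<otimes> d" "cmp x c * cmp y d" g] g(1)
      by (auto simp: Rd_mult cmp_in split: if_splits)
    then show ?thesis using f c d by (auto simp: hom_def)
  qed
  then show ?thesis by (subst graded_span_iff) auto
qed

lemma pushforward_grading:
  assumes E: "comm_group E" and f: "f \<in> hom D E"
  shows "is_grading E (\<lambda>e. graded_span Rd {g\<in>carrier D. f g = e})"
  unfolding is_grading_def
proof (intro conjI ballI allI)
  fix e x y assume "e \<in> carrier E"
  show "0 \<in> graded_span Rd {g\<in>carrier D. f g = e}"
    by (subst graded_span_iff) (auto simp: supp_def cmp_zero)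
  assume xy: "x \<in> graded_span Rd {g\<in>carrier D. f g = e}" "y \<in> graded_span Rd {g\<in>carrier D. f g = e}"
  have "cmp x d = cmp (x - y) d + cmp y d" if "d \<in> carrier D" for d
    using cmp_add[OF that, of "x - y" y] by simp
  then have "supp (x - y) \<subseteq> supp x \<union> supp y"
    by (auto simp: supp_def)
  then show "x - y \<in> graded_span Rd {g\<in>carrier D. f g = e}"
    using xy by (auto simp: graded_span_iff)
next
  fix r :: 'r
  let ?P = "\<lambda>x. x \<in> extensional (carrier E) \<and> (\<forall>d\<in>carrier E. x d \<in> graded_span Rd {g\<in>carrier D. f g = d})
     \<and> finite {d\<in>carrier E. x d \<noteq> 0} \<and> r = (\<Sum>d\<in>{d\<in>carrier E. x d \<noteq> 0}. x d)"
  \<comment> \<open>The piece over \<open>e\<close> has to collect all components of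
    \<open>r\<close> with degree in the fibre over \<open>e\<close>.\<close>
  define x where "x = (\<lambda>e\<in>carrier E. \<Sum>d\<in>{d\<in>supp r. f d = e}. cmp r d)"
  have fE: "f d \<in> carrier E" if "d \<in> carrier D" for d using f that by (auto simp: hom_def)
  have sub: "{e\<in>carrier E. x e \<noteq> 0} \<subseteq> f ` supp r"
  proof
    fix e assume "e \<in> {e\<in>carrier E. x e \<noteq> 0}"
    then have "(\<Sum>d\<in>{d\<in>supp r. f d = e}. cmp r d) \<noteq> 0" unfolding x_def by (auto split: if_splits)
    then have "{d\<in>supp r. f d = e} \<noteq> {}" by (metis sum.empty)
    then show "e \<in> f ` supp r" by blast
  qed
  have fin: "finite (f ` supp r)" using finite_supp by blast
  have "(\<Sum>e\<in>{e\<in>carrier E. x e \<noteq> 0}. x e) = (\<Sum>e\<in>f ` supp r. x e)"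
    using sub fin fE supp_carrier by (intro sum.mono_neutral_left) auto
  also have "\<dots> = (\<Sum>e\<in>f ` supp r. \<Sum>d\<in>{d\<in>supp r. f d = e}. cmp r d)"
    using fE supp_carrier by (intro sum.cong) (auto simp: x_def subset_iff)
  also have "\<dots> = r"
    using sum.image_gen[OF finite_supp, of "cmp r" r f] by (simp only: sum_cmp)
  finally have sum: "r = (\<Sum>e\<in>{e\<in>carrier E. x e \<noteq> 0}. x e)" ..
  have xin: "x e \<in> graded_span Rd {g\<in>carrier D. f g = e}" if e: "e \<in> carrier E" for e
    unfolding graded_span_def using e finite_supp[of r] supp_carrier[of r] cmp_in[of _ r]
    by (intro CollectI exI[of _ "{d\<in>supp r. f d = e}"] exI[of _ "cmp r"]) (auto simp: x_def)
  have P: "?P x"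
    using xin finite_subset[OF sub fin] by (intro conjI ballI sum) (simp_all add: x_def)
  \<comment> \<open>Uniqueness is checked in the finer grading: \<open>y e\<close> has components
    only in the fibre over \<open>e\<close>, so at \<open>d\<close> the member over
    \<open>f d\<close> alone contributes, and it must contribute \<open>cmp r d\<close>.\<close>
  have det: "cmp (y e) d = (if f d = e then cmp r d else 0)"
    if y: "?P y" and e: "e \<in> carrier E" and d: "d \<in> carrier D" for y e d
  proof -
    have yin: "\<And>e. e \<in> carrier E \<Longrightarrow> y e \<in> graded_span Rd {g\<in>carrier D. f g = e}"
      and fin: "finite {d\<in>carrier E. y d \<noteq> 0}"
      and yr: "r = (\<Sum>d\<in>{d\<in>carrier E. y d \<noteq> 0}. y d)"
      using y by auto
    have zero: "cmp (y e') d = 0" if "e' \<in> carrier E" "f d \<noteq> e'" for e'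
    proof -
      have "supp (y e') \<subseteq> {g\<in>carrier D. f g = e'}"
        by (rule graded_span_iff[THEN iffD1, OF _ yin[OF that(1)]]) blast
      then show ?thesis using that d by (auto simp: supp_def)
    qed
    have "cmp r d = cmp (\<Sum>d\<in>{d\<in>carrier E. y d \<noteq> 0}. y d) d" by (simp only: yr[symmetric])
    also have "\<dots> = (\<Sum>e\<in>{d\<in>carrier E. y d \<noteq> 0}. cmp (y e) d)" using d by (rule cmp_sum)
    also have "\<dots> = (\<Sum>e\<in>{d\<in>carrier E. y d \<noteq> 0}. if e = f d then cmp (y e) d else 0)"
      using zero by (intro sum.cong) auto
    also have "\<dots> = cmp (y (f d)) d"
      using fE[OF d] cmp_zero[OF d] fin by (simp add: sum.delta')
    finally show ?thesis using zero[OF e] by simp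
  qed
  show "\<exists>!x. ?P x"
  proof (rule ex1I[of ?P, OF P])
    fix y assume y: "?P y"
    show "y = x"
    proof (rule extensionalityI[of _ "carrier E"])
      fix e assume e: "e \<in> carrier E"
      show "y e = x e"
        by (rule cmp_eqI) (simp only: det[OF y e] det[OF P e])
    qed (use y P in blast)+
  qed
qed (rule E, rule pushforward_mult[OF E f])

end

lemma graded_ringI: "is_grading D Rd \<Longrightarrow> graded_ring D Rd"
  unfolding graded_ring_def graded_ring_axioms_def is_grading_def by blast

lemma (in graded_ring) graded_span_singleton:
  assumes "d \<in> carrier D" shows "graded_span Rd {d} = Rd d"
proof -
  have "r \<in> Rd d" if "supp r \<subseteq> {d}" for r
    using sum_cmp_superset[of "{d}" r] that cmp_in[of d r] assms by auto
  moreover have "supp r \<subseteq> {d}" if "r \<in> Rd d" for r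
    using that assms by (auto simp: supp_def cmp_homogeneous split: if_splits)
  ultimately show ?thesis using assms by (auto simp: graded_span_iff)
qed

text \<open>The definition of \<open>universal_grading\<close> tests only gradings by groups on type \<open>nat\<close>.\<close>
lemma universal_grading_countable:
  fixes D :: "('d, 'm) monoid_scheme" and Rd :: "'g \<Rightarrow> 'r::comm_ring_1 set"
  assumes univ: "universal_grading G Rd" and D: "is_grading D R'" and count: "countable (carrier D)"
  shows "\<exists>!f. f \<in> hom G D \<and> f \<in> extensional (carrier G) \<and>
    (\<forall>e\<in>carrier D. R' e = graded_span Rd {g\<in>carrier G. f g = e})"
proof -
  interpret D: graded_ring D R' using D by (rule graded_ringI)
  define \<phi> where "\<phi> = to_nat_on (carrier D)"
  define \<psi> where "\<psi> = inv_into (carrier D) \<phi>"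
  \<comment> \<open>Transport of structure: \<open>E\<close> is a copy of \<open>D\<close> on
    natural numbers. Pushing forward along the injective \<open>\<phi>\<close> merely renames
    degrees, so the homomorphism that universality gives for \<open>E\<close> comes back to
    \<open>D\<close> by composition with \<open>\<psi>\<close>.\<close>
  define E :: "nat monoid" where
    "E = \<lparr>carrier = \<phi> ` carrier D, monoid.mult = (\<lambda>a b. \<phi> (\<psi> a \<otimes>\<^bsub>D\<^esub> \<psi> b)), one = \<phi> \<one>\<^bsub>D\<^esub>\<rparr>"
  have inj: "inj_on \<phi> (carrier D)" using count unfolding \<phi>_def by (rule inj_on_to_nat_on)
  then have \<psi>\<phi>: "\<psi> (\<phi> d) = d" if "d \<in> carrier D" for d using that by (simp add: \<psi>_def)
  have "comm_group E"
    by (rule comm_groupI)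
      (auto simp: E_def \<psi>\<phi> D.m_ac intro!: bexI[of _ "inv\<^bsub>D\<^esub> _"] image_eqI[OF refl])
  moreover have \<phi>hom: "\<phi> \<in> hom D E"
    by (auto simp: hom_def E_def \<psi>\<phi>)
  ultimately have gr: "is_grading E (\<lambda>e. graded_span R' {d\<in>carrier D. \<phi> d = e})"
    by (rule D.pushforward_grading)
  have univ': "\<exists>!f. f \<in> hom G E \<and> f \<in> extensional (carrier G) \<and>
      (\<forall>e\<in>carrier E. Re e = graded_span Rd {g\<in>carrier G. f g = e})"
    if "is_grading E Re" for Re
    using univ that unfolding universal_grading_def by blast
  have ex1: "\<exists>!f. f \<in> hom G E \<and> f \<in> extensional (carrier G) \<and>
      (\<forall>e\<in>carrier E. graded_span R' {d\<in>carrier D. \<phi> d = e} = graded_span Rd {g\<in>carrier G. f g = e})"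
    by (rule univ'[OF gr])
  have span: "graded_span R' {d\<in>carrier D. \<phi> d = \<phi> e} = R' e" if "e \<in> carrier D" for e
  proof -
    have "{d\<in>carrier D. \<phi> d = \<phi> e} = {e}" using that inj by (auto dest: inj_onD)
    then show ?thesis using that by (simp add: D.graded_span_singleton)
  qed
  let ?P = "\<lambda>f. f \<in> hom G E \<and> f \<in> extensional (carrier G) \<and>
      (\<forall>e\<in>carrier E. graded_span R' {d\<in>carrier D. \<phi> d = e} = graded_span Rd {g\<in>carrier G. f g = e})"
  from ex1 obtain f where Pf: "?P f" and uniq: "\<And>h. ?P h \<Longrightarrow> h = f"
    by (rule ex1E) (rule that, assumption, drule spec, erule mp)
  have f: "f \<in> hom G E" "f \<in> extensional (carrier G)"
    "\<And>e. e \<in> carrier E \<Longrightarrow> graded_span R' {d\<in>carrier D. \<phi> d = e} = graded_span Rd {g\<in>carrier G. f g = e}"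
    using Pf by blast+
  have fE: "f g \<in> \<phi> ` carrier D" if "g \<in> carrier G" for g
    using f(1) that by (auto simp: hom_def E_def)
  have \<phi>\<psi>: "\<phi> (\<psi> (f g)) = f g" "\<psi> (f g) \<in> carrier D" if "g \<in> carrier G" for g
    using fE[OF that] \<psi>\<phi> by auto
  have "monoid G"
    using univ by (simp add: universal_grading_def is_grading_def comm_group_def group.is_monoid)
  then have G_closed: "x \<otimes>\<^bsub>G\<^esub> y \<in> carrier G" if "x \<in> carrier G" "y \<in> carrier G" for x y
    using that by (rule monoid.m_closed)
  show ?thesis
  proof (rule ex1I[of _ "\<lambda>g\<in>carrier G. \<psi> (f g)"], intro conjI ballI)
    show "(\<lambda>g\<in>carrier G. \<psi> (f g)) \<in> hom G D"
    proof (rule homI)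
      fix x y assume xy: "x \<in> carrier G" "y \<in> carrier G"
      then have "f (x \<otimes>\<^bsub>G\<^esub> y) = \<phi> (\<psi> (f x) \<otimes>\<^bsub>D\<^esub> \<psi> (f y))"
        using hom_mult[OF f(1)] by (simp add: E_def)
      then have "\<psi> (f (x \<otimes>\<^bsub>G\<^esub> y)) = \<psi> (f x) \<otimes>\<^bsub>D\<^esub> \<psi> (f y)"
        using xy by (simp add: \<psi>\<phi> \<phi>\<psi>(2))
      then show "(\<lambda>g\<in>carrier G. \<psi> (f g)) (x \<otimes>\<^bsub>G\<^esub> y)
          = (\<lambda>g\<in>carrier G. \<psi> (f g)) x \<otimes>\<^bsub>D\<^esub> (\<lambda>g\<in>carrier G. \<psi> (f g)) y"
        using xy G_closed[OF xy] by simp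
    qed (simp add: \<phi>\<psi>(2))
    show "(\<lambda>g\<in>carrier G. \<psi> (f g)) \<in> extensional (carrier G)" by simp
    fix e assume e: "e \<in> carrier D"
    have "R' e = graded_span R' {d\<in>carrier D. \<phi> d = \<phi> e}" using span[OF e] ..
    also have "\<dots> = graded_span Rd {g\<in>carrier G. f g = \<phi> e}"
      using e by (intro f(3)) (simp add: E_def)
    also have "{g\<in>carrier G. f g = \<phi> e} = {g \<in> carrier G. (\<lambda>g\<in>carrier G. \<psi> (f g)) g = e}"
    proof (intro Collect_cong conj_cong refl)
      fix g assume g: "g \<in> carrier G"
      have "f g = \<phi> e \<longleftrightarrow> \<psi> (f g) = e"
        using \<phi>\<psi>(1)[OF g] \<psi>\<phi>[OF e] by metis
      then show "f g = \<phi> e \<longleftrightarrow> (\<lambda>g\<in>carrier G. \<psi> (f g)) g = e"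
        using g by simp
    qed
    finally show "R' e = graded_span Rd {g \<in> carrier G. (\<lambda>g\<in>carrier G. \<psi> (f g)) g = e}" .
  next
    fix h assume h: "h \<in> hom G D \<and> h \<in> extensional (carrier G) \<and>
      (\<forall>e\<in>carrier D. R' e = graded_span Rd {g\<in>carrier G. h g = e})"
    have hD: "h g \<in> carrier D" if "g \<in> carrier G" for g
      using hom_in_carrier[OF conjunct1[OF h] that] .
    have hom: "(\<lambda>g\<in>carrier G. \<phi> (h g)) \<in> hom G E"
    proof (rule homI)
      fix x y assume xy: "x \<in> carrier G" "y \<in> carrier G"
      have "\<phi> (h (x \<otimes>\<^bsub>G\<^esub> y)) = \<phi> (h x) \<otimes>\<^bsub>E\<^esub> \<phi> (h y)"
        unfolding hom_mult[OF conjunct1[OF h] xy] by (rule hom_mult[OF \<phi>hom hD[OF xy(1)] hD[OF xy(2)]])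
      then show "(\<lambda>g\<in>carrier G. \<phi> (h g)) (x \<otimes>\<^bsub>G\<^esub> y)
          = (\<lambda>g\<in>carrier G. \<phi> (h g)) x \<otimes>\<^bsub>E\<^esub> (\<lambda>g\<in>carrier G. \<phi> (h g)) y"
        using xy G_closed[OF xy] by simp
    qed (use hD in \<open>simp add: E_def\<close>)
    have "(\<lambda>g\<in>carrier G. \<phi> (h g)) = f"
    proof (rule uniq, intro conjI ballI hom)
      fix e assume "e \<in> carrier E"
      then obtain d where d: "d \<in> carrier D" "e = \<phi> d" by (auto simp: E_def)
      have "\<phi> (h g) = \<phi> d \<longleftrightarrow> h g = d" if "g \<in> carrier G" for g
        using inj hD[OF that] d(1) by (rule inj_on_eq_iff)
      then have "{g\<in>carrier G. (\<lambda>g\<in>carrier G. \<phi> (h g)) g = e} = {g\<in>carrier G. h g = d}"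
        unfolding d(2) by auto
      then show "graded_span R' {d\<in>carrier D. \<phi> d = e}
          = graded_span Rd {g\<in>carrier G. (\<lambda>g\<in>carrier G. \<phi> (h g)) g = e}"
        using span[OF d(1)] h d by (simp only:)
    qed simp
    then have "f g = \<phi> (h g)" if "g \<in> carrier G" for g
      using that by (metis restrict_apply')
    then show "h = (\<lambda>g\<in>carrier G. \<psi> (f g))"
      using h hD \<psi>\<phi> by (intro extensionalityI[of _ "carrier G"]) auto
  qed
qed

section \<open>Separation by characters\<close>

text \<open>Lets subsets of a ring serve as groups of degrees: the roots of unity in C and in R, and
  the group \<open>H\<close> of a decomposition.\<close>

definition mult_group :: "'r::comm_ring_1 set \<Rightarrow> 'r monoid" where
  "mult_group H = \<lparr>carrier = H, monoid.mult = (*), one = 1\<rparr>"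

lemma mult_group_simps [simp]:
  "carrier (mult_group H) = H" "x \<otimes>\<^bsub>mult_group H\<^esub> y = x * y" "\<one>\<^bsub>mult_group H\<^esub> = 1"
  by (simp_all add: mult_group_def)

lemma comm_group_mult_group: "is_unit_subgroup H \<Longrightarrow> comm_group (mult_group H)"
  by (rule comm_groupI) (auto simp: is_unit_subgroup_def mult.assoc mult.commute)

section \<open>The group of roots of unity\<close>

lemma roots_of_unity_1: "1 \<in> roots_of_unity"
  by (auto simp: roots_of_unity_def)

lemma roots_of_unity_mult: "x \<in> roots_of_unity \<Longrightarrow> y \<in> roots_of_unity \<Longrightarrow> x * y \<in> roots_of_unity"
proof -
  assume "x \<in> roots_of_unity" "y \<in> roots_of_unity"
  then obtain j k :: nat where "j > 0" "k > 0" "x ^ j = 1" "y ^ k = 1"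
    by (auto simp: roots_of_unity_def)
  then have "(x * y) ^ (j * k) = 1"
    by (simp add: power_mult_distrib power_mult[of x j k]) (simp add: mult.commute[of j] power_mult)
  with \<open>j > 0\<close> \<open>k > 0\<close> show ?thesis
    unfolding roots_of_unity_def by (intro CollectI exI[of _ "j * k"]) simp
qed

lemma roots_of_unity_power: "x \<in> roots_of_unity \<Longrightarrow> x ^ k \<in> roots_of_unity"
  by (induction k) (auto intro: roots_of_unity_1 roots_of_unity_mult)

lemma roots_of_unity_inverse: 
  assumes "x \<in> roots_of_unity" shows "\<exists>y\<in>roots_of_unity. x * y = 1"
proof -
  obtain k where "k > 0" "x ^ k = 1" using assms by (auto simp: roots_of_unity_def)
  then have "x * x ^ (k - 1) = 1" by (metis power_eq_if neq0_conv)
  then show ?thesis using roots_of_unity_power[OF assms] by blast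
qed

lemma is_unit_subgroup_roots_of_unity: "is_unit_subgroup roots_of_unity"
  unfolding is_unit_subgroup_def
  using roots_of_unity_1 roots_of_unity_mult roots_of_unity_inverse by blast

text \<open>Only the torsion points of the unit circle: still divisible, hence enough to separate
  elements of abelian groups, but countable, so that universality applies, and such that finitely
  many degrees have a common exponent.\<close>

abbreviation circle :: "complex monoid" where
  "circle \<equiv> mult_group roots_of_unity"

lemma comm_group_circle: "comm_group circle"
  by (rule comm_group_mult_group) (rule is_unit_subgroup_roots_of_unity)

lemma countable_circle: "countable (carrier circle)"
proof -
  have "carrier circle = (\<Union>k\<in>{0<..}. {z::complex. z ^ k = 1})"
    by (auto simp: roots_of_unity_def)
  also have "countable \<dots>"
    by (rule countable_UN) (auto intro!: countable_finite finite_roots_unity)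
  finally show ?thesis .
qed

lemma roots_of_unity_nonzero: "(w::complex) \<in> roots_of_unity \<Longrightarrow> w \<noteq> 0"
  by (auto simp: roots_of_unity_def power_0_left)

lemma roots_of_unity_complex_inverse:
  "(w::complex) \<in> roots_of_unity \<Longrightarrow> inverse w \<in> roots_of_unity"
  by (auto simp: roots_of_unity_def power_inverse)

lemma roots_of_unity_power_int: "(w::complex) \<in> roots_of_unity \<Longrightarrow> w powi i \<in> roots_of_unity"
  by (simp add: power_int_def roots_of_unity_power roots_of_unity_complex_inverse)

context comm_group
begin

text \<open>Graphs of characters on subgroups, so that unions of chains are immediate in Zorn's lemma.\<close>
definition partial_character :: "('a \<times> complex) set \<Rightarrow> bool" where
  "partial_character K \<longleftrightarrow> K \<subseteq> carrier G \<times> roots_of_unity \<and> (\<one>, 1) \<in> K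
     \<and> (\<forall>x a y b. (x, a) \<in> K \<longrightarrow> (y, b) \<in> K \<longrightarrow> (x \<otimes> y, a * b) \<in> K)
     \<and> (\<forall>x a. (x, a) \<in> K \<longrightarrow> (inv x, inverse a) \<in> K)
     \<and> (\<forall>a. (\<one>, a) \<in> K \<longrightarrow> a = 1)"

lemma partial_characterD:
  assumes "partial_character K"
  shows "(x, a) \<in> K \<Longrightarrow> x \<in> carrier G" "(x, a) \<in> K \<Longrightarrow> a \<in> roots_of_unity" "(\<one>, 1) \<in> K"
    "(x, a) \<in> K \<Longrightarrow> (y, b) \<in> K \<Longrightarrow> (x \<otimes> y, a * b) \<in> K"
    "(x, a) \<in> K \<Longrightarrow> (inv x, inverse a) \<in> K" "(\<one>, a) \<in> K \<Longrightarrow> a = 1"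
  using assms unfolding partial_character_def by blast+

text \<open>Single-valuedness is demanded in the definition only over the identity; dividing one
  pair by the other carries it to every point.\<close>

lemma partial_character_unique:
  assumes K: "partial_character K" and "(x, a) \<in> K" "(x, b) \<in> K"
  shows "a = b"
proof -
  have "(x \<otimes> inv x, a * inverse b) \<in> K"
    using assms by (intro partial_characterD(4)[OF K] partial_characterD(5)[OF K])
  then have "a * inverse b = 1"
    using partial_characterD(1)[OF assms(1,2)] by (auto intro: partial_characterD(6)[OF K])
  moreover have "b \<noteq> 0" using partial_characterD(2)[OF K assms(3)] roots_of_unity_nonzero by blast
  ultimately show ?thesis by (simp add: field_simps)
qed

lemma partial_character_pow:
  fixes n :: nat
  assumes K: "partial_character K" and "(x, a) \<in> K"
  shows "(x [^] n, a ^ n) \<in> K"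
proof (induction n)
  case (Suc n)
  then show ?case
    using partial_characterD(4)[OF K Suc assms(2)] by (simp add: mult.commute)
qed (simp add: partial_characterD(3)[OF K])

lemma int_pow_nonneg: "0 \<le> i \<Longrightarrow> x [^] (i::int) = x [^] nat i"
  by (subst int_pow_def2, rule if_not_P) simp

lemma int_pow_negative: "i < 0 \<Longrightarrow> x [^] (i::int) = inv (x [^] nat (- i))"
  by (subst int_pow_def2, rule if_P)

lemma partial_character_int_pow:
  fixes i :: int
  assumes K: "partial_character K" and xa: "(x, a) \<in> K"
  shows "(x [^] i, a powi i) \<in> K"
proof (cases "i \<ge> 0")
  case True
  then have "x [^] i = x [^] nat i" by (rule int_pow_nonneg)
  moreover have "a powi i = a ^ nat i" using True unfolding power_int_def by (rule if_P)
  ultimately show ?thesis using partial_character_pow[OF assms, of "nat i"] by (simp only:)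
next
  case False
  then have "x [^] i = inv (x [^] nat (- i))" by (intro int_pow_negative) simp
  moreover have "a powi i = inverse (a ^ nat (- i))"
    using False unfolding power_int_def power_inverse[symmetric] by (rule if_not_P)
  ultimately show ?thesis
    using partial_characterD(5)[OF K partial_character_pow[OF assms, of "nat (-i)"]] by (simp only:)
qed

text \<open>The extension sends \<open>h \<otimes> x [^] i\<close> to \<open>z * w powi i\<close>
  for \<open>(h, z)\<close> in \<open>K\<close>. By the previous reduction its well-definedness only
  has to be tested over \<one>, where \<open>h\<close> is a power of \<open>x\<close>;
  \<open>compat\<close> settles exactly this case.\<close>

lemma partial_character_extend:
  assumes K: "partial_character K" and x: "x \<in> carrier G" and w: "w \<in> roots_of_unity"
    and compat: "\<And>i z. (x [^] (i::int), z) \<in> K \<Longrightarrow> z = w powi i"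
  shows "\<exists>K'. partial_character K' \<and> K \<subseteq> K' \<and> (x, w) \<in> K'"
proof -
  note KD = partial_characterD[OF K]
  have w0: "w \<noteq> 0" using w by (rule roots_of_unity_nonzero)
  define K' where "K' = {(h \<otimes> x [^] i, z * w powi i) | h z (i::int). (h, z) \<in> K}"
  have K'I: "(y, a) \<in> K'" if "(h, z) \<in> K" "y = h \<otimes> x [^] i" "a = z * w powi i" for y a h z and i :: int
    unfolding K'_def using that by blast
  have "partial_character K'"
    unfolding partial_character_def
  proof (intro conjI allI impI)
    show "K' \<subseteq> carrier G \<times> roots_of_unity"
      using KD(1,2) x w by (auto simp: K'_def intro!: roots_of_unity_mult roots_of_unity_power_int)
    show "(\<one>, 1) \<in> K'" by (rule K'I[OF KD(3), of _ 0]) auto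
  next
    fix y a y' b assume "(y, a) \<in> K'" "(y', b) \<in> K'"
    then obtain h z i h' z' j where h: "(h, z) \<in> K" "y = h \<otimes> x [^] (i::int)" "a = z * w powi i"
      and h': "(h', z') \<in> K" "y' = h' \<otimes> x [^] (j::int)" "b = z' * w powi j"
      unfolding K'_def by blast
    have "y \<otimes> y' = (h \<otimes> h') \<otimes> x [^] (i + j)"
      using KD(1)[OF h(1)] KD(1)[OF h'(1)] x unfolding h h' by (simp add: int_pow_mult m_ac)
    moreover have "a * b = (z * z') * w powi (i + j)"
      using w0 unfolding h h' by (simp add: power_int_add)
    ultimately show "(y \<otimes> y', a * b) \<in> K'"
      by (rule K'I[OF KD(4)[OF h(1) h'(1)]])
  next
    fix y a assume "(y, a) \<in> K'"
    then obtain h z i where h: "(h, z) \<in> K" "y = h \<otimes> x [^] (i::int)" "a = z * w powi i"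
      unfolding K'_def by blast
    have "inv y = inv h \<otimes> x [^] (- i)"
      using KD(1)[OF h(1)] x unfolding h by (simp add: int_pow_neg inv_mult)
    moreover have "inverse a = inverse z * w powi (- i)"
      unfolding h by (simp add: power_int_minus)
    ultimately show "(inv y, inverse a) \<in> K'"
      by (rule K'I[OF KD(5)[OF h(1)]])
  next
    fix a assume "(\<one>, a) \<in> K'"
    then obtain h z i where h: "(h, z) \<in> K" "\<one> = h \<otimes> x [^] (i::int)" "a = z * w powi i"
      unfolding K'_def by blast
    have "h = x [^] (- i)"
      using KD(1)[OF h(1)] x h(2) by (metis int_pow_closed int_pow_neg inv_equality inv_inv)
    then have "z = w powi (- i)" using h(1) compat by blast
    then show "a = 1" using w0 h(3) by (simp add: power_int_minus)
  qed
  moreover have "K \<subseteq> K'"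
    using KD(1) by (auto intro!: K'I[of _ _ _ 0])
  moreover have "(x, w) \<in> K'"
    using x by (intro K'I[OF KD(3), of _ 1]) auto
  ultimately show ?thesis by blast
qed

text \<open>Divisibility of the roots of unity, with a choice left over. If no positive power of
  \<open>x\<close> lies in the domain, the value is free and -1 serves. Otherwise the least such
  exponent \<open>k\<close> is at least 2, since \<open>x\<close> itself is outside the domain, and
  the prescribed value at the \<open>k\<close>-th power has \<open>k\<close> distinct
  \<open>k\<close>-th roots, not all equal to 1.\<close>

lemma partial_character_value:
  assumes K: "partial_character K" and x: "x \<in> carrier G" "x \<notin> Domain K"
  shows "\<exists>w\<in>roots_of_unity. w \<noteq> 1 \<and> (\<forall>i z. (x [^] (i::int), z) \<in> K \<longrightarrow> z = w powi i)"
proof (cases "\<exists>k>0. x [^] (k::nat) \<in> Domain K")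
  case False
  have nonneg: "x [^] (k::nat) \<notin> Domain K" if "k > 0" for k using False that by blast
  have trivial: "i = 0" if z: "(x [^] (i::int), z) \<in> K" for i z
  proof (cases i "0::int" rule: linorder_cases)
    case greater
    then have "x [^] i = x [^] nat i" by (intro int_pow_nonneg) simp
    with z have "x [^] nat i \<in> Domain K" by (simp only: DomainI)
    moreover have "nat i > 0" using greater by simp
    ultimately show ?thesis using nonneg by blast
  next
    case less
    then have "x [^] i = inv (x [^] nat (- i))" by (rule int_pow_negative)
    then have "inv (x [^] i) = x [^] nat (- i)" using x(1) by (simp only: inv_inv nat_pow_closed)
    with partial_characterD(5)[OF K z] have "x [^] nat (- i) \<in> Domain K" by (simp only: DomainI)
    moreover have "nat (- i) > 0" using less by simp
    ultimately show ?thesis using nonneg by blast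
  qed
  have "z = (-1) powi i" if z: "(x [^] (i::int), z) \<in> K" for i z
  proof -
    have "i = 0" using z by (rule trivial)
    with z have "(\<one>, z) \<in> K" by simp
    with \<open>i = 0\<close> show ?thesis using partial_characterD(6)[OF K] by simp
  qed
  moreover have "(-1::complex) \<in> roots_of_unity"
    by (auto simp: roots_of_unity_def intro!: exI[of _ 2])
  ultimately show ?thesis by (intro bexI[of _ "-1"]) auto
next
  case True
  define k where "k = (LEAST k. k > 0 \<and> x [^] (k::nat) \<in> Domain K)"
  have k: "k > 0" "x [^] k \<in> Domain K"
    using LeastI_ex[OF True] by (simp_all add: k_def)
  have min: "j = 0" if "j < k" "x [^] j \<in> Domain K" for j
    using not_less_Least[of j "\<lambda>k. k > 0 \<and> x [^] (k::nat) \<in> Domain K"] that by (auto simp: k_def)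
  obtain y where y: "(x [^] k, y) \<in> K" using k(2) by blast
  have "k \<noteq> 1" using k(2) x by auto
  then have "k \<ge> 2" using k(1) by simp
  have yU: "y \<in> roots_of_unity" using partial_characterD(2)[OF K y] .
  then have "card {w. w ^ k = y} = k"
    using roots_of_unity_nonzero k(1) by (intro card_nth_roots) auto
  with \<open>k \<ge> 2\<close> have "\<not> {w. w ^ k = y} \<subseteq> {1}"
    using card_mono[of "{1::complex}" "{w. w ^ k = y}"] by auto
  then obtain w where w: "w ^ k = y" "w \<noteq> 1" by blast
  have "w \<in> roots_of_unity"
  proof -
    obtain n where "n > 0" "y ^ n = 1" using yU by (auto simp: roots_of_unity_def)
    then have "w ^ (k * n) = 1" unfolding power_mult w(1) by simp
    with \<open>n > 0\<close> k(1) show ?thesis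
      unfolding roots_of_unity_def by (intro CollectI exI[of _ "k * n"]) simp
  qed
  moreover have "z = w powi i" if z: "(x [^] (i::int), z) \<in> K" for i z
  proof -
    \<comment> \<open>Division with remainder: the power of \<open>x\<close> with exponent
      \<open>i mod int k\<close> is again in the domain, so minimality of \<open>k\<close> forces
      the remainder to be 0.\<close>
    define q where "q = i div int k"
    have kq: "(x [^] (int k * q), y powi q) \<in> K"
      using partial_character_int_pow[OF K y, of q] int_pow_pow[OF x(1), of "int k" q]
      by (simp only: int_pow_int)
    have "i mod int k = i - int k * q"
      unfolding q_def by (rule minus_mult_div_eq_mod[symmetric])
    then have "x [^] (i mod int k) = x [^] i \<otimes> inv (x [^] (int k * q))"
      using x by (simp only: int_pow_diff)
    then have "x [^] (i mod int k) \<in> Domain K"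
      using partial_characterD(4)[OF K z partial_characterD(5)[OF K kq]] by (simp only: DomainI)
    then have "x [^] nat (i mod int k) \<in> Domain K"
      using k(1) by (subst int_pow_nonneg[symmetric]) simp_all
    moreover have mod: "i mod int k \<ge> 0" "i mod int k < int k" using k(1) by simp_all
    then have "nat (i mod int k) < k" by (simp only: nat_less_iff)
    ultimately have "nat (i mod int k) = 0" using min by blast
    then have "i mod int k = 0" using mod(1) by simp
    then have i: "i = int k * q" using mult_div_mod_eq[of "int k" i] unfolding q_def by simp
    then have "z = y powi q"
      using partial_character_unique[OF K z] kq by simp
    then show ?thesis by (simp add: i w(1)[symmetric] power_int_mult)
  qed
  ultimately show ?thesis using w(2) by blast
qed

lemma partial_character_extend_nontrivial:
  assumes K: "partial_character K" and x: "x \<in> carrier G" "x \<notin> Domain K"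
  shows "\<exists>K' w. partial_character K' \<and> K \<subseteq> K' \<and> (x, w) \<in> K' \<and> w \<noteq> 1"
proof -
  obtain w where w: "w \<in> roots_of_unity" "w \<noteq> 1"
    and compat: "\<And>i z. (x [^] (i::int), z) \<in> K \<Longrightarrow> z = w powi i"
    using partial_character_value[OF assms] by blast
  show ?thesis
    using partial_character_extend[OF K x(1) w(1) compat] w(2) by blast
qed

text \<open>Used twice: with the trivial subgroup it separates points, and with the subgroup
  generated by the degrees that occur in R it would detect a degree outside of it.\<close>

lemma exists_separating_character:
  assumes M: "subgroup M G" and g: "g \<in> carrier G" "g \<notin> M"
  shows "\<exists>\<chi>\<in>hom G circle. (\<forall>x\<in>M. \<chi> x = 1) \<and> \<chi> g \<noteq> 1"
proof -
  have "partial_character (M \<times> {1})"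
    unfolding partial_character_def
    using subgroup.subset[OF M] subgroup.one_closed[OF M] subgroup.m_closed[OF M]
      subgroup.m_inv_closed[OF M] roots_of_unity_1 by auto
  moreover have "g \<notin> Domain (M \<times> {1})" using g by auto
  ultimately obtain w K0 where w: "w \<noteq> 1" and K0: "partial_character K0" "M \<times> {1} \<subseteq> K0" "(g, w) \<in> K0"
    using partial_character_extend_nontrivial[of "M \<times> {1}" g] g(1) by blast
  \<comment> \<open>Zorn's lemma runs only over the extensions of \<open>K0\<close>, so triviality
    on \<open>M\<close> and the value \<open>w\<close> at \<open>g\<close> are kept; what is left to
    gain is the domain.\<close>
  define \<P> where "\<P> = {K. partial_character K \<and> K0 \<subseteq> K}"
  have "\<exists>K\<in>\<P>. \<forall>L\<in>\<P>. K \<subseteq> L \<longrightarrow> L = K"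
  proof (rule subset_Zorn_nonempty)
    show "\<P> \<noteq> {}" using K0 by (auto simp: \<P>_def)
    fix C assume C: "C \<noteq> {}" "subset.chain \<P> C"
    have CA: "partial_character K" "K0 \<subseteq> K" if "K \<in> C" for K
      using C(2) that by (auto simp: \<P>_def subset.chain_def)
    have "partial_character (\<Union>C)"
      unfolding partial_character_def
    proof (intro conjI allI impI)
      show "\<Union>C \<subseteq> carrier G \<times> roots_of_unity"
        using CA(1) unfolding partial_character_def by blast
      obtain K where "K \<in> C" using C(1) by blast
      then show "(\<one>, 1) \<in> \<Union>C" using partial_characterD(3)[OF CA(1)] by (intro UnionI)
    next
      fix a assume "(\<one>, a) \<in> \<Union>C"
      then obtain K where "K \<in> C" "(\<one>, a) \<in> K" by (rule UnionE)
      then show "a = 1" by (intro partial_characterD(6)[OF CA(1)])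
    next
      fix x a assume "(x, a) \<in> \<Union>C"
      then obtain K where "K \<in> C" "(x, a) \<in> K" by (rule UnionE)
      then show "(inv x, inverse a) \<in> \<Union>C" by (intro UnionI partial_characterD(5)[OF CA(1)])
    next
      fix x a y b assume "(x, a) \<in> \<Union>C" "(y, b) \<in> \<Union>C"
      then obtain K L where KL: "K \<in> C" "L \<in> C" "(x, a) \<in> K" "(y, b) \<in> L" by blast
      then have "K \<subseteq> L \<or> L \<subseteq> K"
        using C(2) by (auto simp: subset.chain_def)
      with KL obtain N where "N \<in> C" "(x, a) \<in> N" "(y, b) \<in> N" by blast
      then show "(x \<otimes> y, a * b) \<in> \<Union>C"
        by (intro UnionI partial_characterD(4)[OF CA(1)])
    qed
    then show "\<Union>C \<in> \<P>" using C(1) CA(2) unfolding \<P>_def by blast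
  qed
  then obtain K where "K \<in> \<P>" and maxP: "\<forall>L\<in>\<P>. K \<subseteq> L \<longrightarrow> L = K" by (rule bexE)
  then have K: "partial_character K" "K0 \<subseteq> K" by (simp_all add: \<P>_def)
  have max: "L = K" if "partial_character L" "K \<subseteq> L" for L
    using maxP that K(2) by (simp add: \<P>_def)
  have "x \<in> Domain K" if "x \<in> carrier G" for x
  proof (rule ccontr)
    assume "x \<notin> Domain K"
    with that partial_character_extend_nontrivial[OF K(1)]
    obtain v K' where "partial_character K'" "K \<subseteq> K'" "(x, v) \<in> K'" by blast
    with max \<open>x \<notin> Domain K\<close> show False by blast
  qed
  then have "\<forall>x\<in>carrier G. \<exists>a. (x, a) \<in> K" by blast
  from bchoice[OF this] obtain \<chi> where "\<forall>x\<in>carrier G. (x, \<chi> x) \<in> K" ..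
  then have \<chi>: "(x, \<chi> x) \<in> K" if "x \<in> carrier G" for x using that by (rule bspec)
  have \<chi>_eq: "\<chi> x = a" if "(x, a) \<in> K" for x a
    using partial_character_unique[OF K(1) \<chi>[OF partial_characterD(1)[OF K(1) that]] that] .
  have "\<chi> \<in> hom G circle"
  proof (rule homI)
    fix x y assume "x \<in> carrier G" "y \<in> carrier G"
    then have "(x \<otimes> y, \<chi> x * \<chi> y) \<in> K" by (intro partial_characterD(4)[OF K(1)] \<chi>)
    then show "\<chi> (x \<otimes> y) = \<chi> x \<otimes>\<^bsub>circle\<^esub> \<chi> y" by (simp add: \<chi>_eq)
  qed (use \<chi> partial_characterD(2)[OF K(1)] in auto)
  moreover have "\<chi> x = 1" if "x \<in> M" for x using that K0(2) K(2) by (intro \<chi>_eq) blast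
  moreover have "\<chi> g \<noteq> 1" using w K0(3) K(2) \<chi>_eq by blast
  ultimately show ?thesis by blast
qed

end

section \<open>Finiteness and idempotents in orders\<close>

lemma sum_powers_root_of_unity:
  fixes z :: "'a::field"
  assumes "z ^ m = 1"
  shows "(\<Sum>a<m. z ^ a) = (if z = 1 then of_nat m else 0)"
proof (cases "z = 1")
  case False
  have "(z - 1) * (\<Sum>a<m. z ^ a) = 0"
    using power_diff_1_eq[of z m] assms by simp
  then show ?thesis using False by simp
qed simp

lemma common_exponent:
  assumes "finite W" "W \<subseteq> roots_of_unity"
  shows "\<exists>m>0. \<forall>w\<in>W. w ^ m = 1"
  using assms
proof (induction W)
  case (insert w W)
  then obtain m k where "m > 0" "\<forall>w\<in>W. w ^ m = 1" "k > 0" "w ^ k = 1"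
    by (auto simp: roots_of_unity_def)
  then have "\<forall>v\<in>insert w W. v ^ (m * k) = 1"
    by (auto simp: power_mult power_mult[of w k m] mult.commute[of m k])
       (metis power_mult power_one mult.commute)+
  with \<open>m > 0\<close> \<open>k > 0\<close> show ?case by (intro exI[of _ "m * k"]) simp
qed auto

text \<open>Stands in for the finite abelian group generated by the maps: only the orbit of
  \<open>x\<close> is built, adding one map at a time. Closing under powers of the new map preserves
  stability under the earlier ones because the maps commute, and the period bounds the
  exponents.\<close>

lemma finite_commuting_closure:
  fixes f :: "'i \<Rightarrow> 'x \<Rightarrow> 'x"
  assumes "finite A" and x: "x \<in> Y" and N: "N > 0"
    and closed: "\<And>a y. y \<in> Y \<Longrightarrow> f a y \<in> Y"
    and comm: "\<And>a b y. y \<in> Y \<Longrightarrow> f a (f b y) = f b (f a y)"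
    and period: "\<And>a y. y \<in> Y \<Longrightarrow> (f a ^^ N) y = y"
  shows "\<exists>S\<subseteq>Y. finite S \<and> x \<in> S \<and> (\<forall>a\<in>A. f a ` S \<subseteq> S)"
  using \<open>finite A\<close>
proof (induction A)
  case empty
  then show ?case using x by (intro exI[of _ "{x}"]) auto
next
  case (insert a A)
  then obtain S where S: "S \<subseteq> Y" "finite S" "x \<in> S" "\<And>b. b \<in> A \<Longrightarrow> f b ` S \<subseteq> S" by auto
  define S' where "S' = (\<Union>i<N. (f a ^^ i) ` S)"
  have pow: "(f a ^^ i) y \<in> Y" "f b ((f a ^^ i) y) = (f a ^^ i) (f b y)" if "y \<in> Y" for i y b
  proof (induction i)
    case (Suc i)
    case 1 show ?case using Suc(1) closed by simp
    case 2 show ?case using Suc comm[OF Suc(1), of b a] by simp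
  qed (use that in auto)
  have S'I: "(f a ^^ i) s \<in> S'" if "s \<in> S" "i < N" for i s
    using that by (auto simp: S'_def)
  have "f b ` S' \<subseteq> S'" if b: "b \<in> insert a A" for b
  proof
    fix t assume "t \<in> f b ` S'"
    then obtain i s where s: "i < N" "s \<in> S" "t = f b ((f a ^^ i) s)" by (auto simp: S'_def)
    have sX: "s \<in> Y" using s(2) S(1) by blast
    show "t \<in> S'"
    proof (cases "b = a")
      case True
      then have t: "t = (f a ^^ Suc i) s" using s(3) by simp
      show ?thesis
      proof (cases "Suc i < N")
        case True
        then show ?thesis unfolding t by (rule S'I[OF s(2)])
      next
        case False
        \<comment> \<open>At the last exponent one more application wraps around to exponent 0,
          which is available because \<open>N > 0\<close>.\<close>
        then have "Suc i = N" using s(1) by simp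
        then have "t = (f a ^^ 0) s" unfolding t using period[OF sX, of a] by simp
        then show ?thesis using S'I[OF s(2) N] by simp
      qed
    next
      case False
      then have "f b s \<in> S" using S(4)[of b] s(2) b by blast
      moreover have "t = (f a ^^ i) (f b s)" using s(3) pow(2)[OF sX] by simp
      ultimately show ?thesis using S'I s(1) by simp
    qed
  qed
  moreover have "x \<in> S'" using S'I[OF S(3) N] by simp
  moreover have "S' \<subseteq> Y" using pow(1) S(1) by (auto simp: S'_def)
  moreover have "finite S'" using S(2) by (simp add: S'_def)
  ultimately show ?case by blast
qed

text \<open>Coordinates for a Z-basis. Additivity makes them functionals to which twists apply;
  integrality and joint injectivity turn boundedness into finiteness.\<close>

lemma order_coordinates:
  assumes "is_order TYPE('r::comm_ring_1)"
  shows "\<exists>(n::nat) (c::nat \<Rightarrow> 'r \<Rightarrow> int). (\<forall>j x y. c j (x + y) = c j x + c j y)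
    \<and> (\<forall>x y. (\<forall>j<n. c j x = c j y) \<longrightarrow> x = y)"
proof -
  obtain n and b :: "nat \<Rightarrow> 'r" where
    ex1: "\<And>r. \<exists>!c::nat \<Rightarrow> int. (\<forall>i\<ge>n. c i = 0) \<and> r = (\<Sum>i<n. of_int (c i) * b i)"
    using assms unfolding is_order_def by blast
  define c where "c j r = (THE c::nat \<Rightarrow> int. (\<forall>i\<ge>n. c i = 0) \<and> r = (\<Sum>i<n. of_int (c i) * b i)) j" for j r
  have c: "\<forall>i\<ge>n. c i r = 0" "r = (\<Sum>i<n. of_int (c i r) * b i)" for r
    using theI'[OF ex1[of r]] by (simp_all add: c_def)
  have uniq: "d = (\<lambda>i. c i r)" if "\<forall>i\<ge>n. d i = 0" "r = (\<Sum>i<n. of_int (d i) * b i)" for d r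
    using ex1[of r] c[of r] that by (elim ex1E) metis
  show ?thesis
  proof (intro exI[of _ n] exI[of _ c] conjI allI impI)
    fix j x y
    have "x + y = (\<Sum>i<n. of_int (c i x + c i y) * b i)"
      by (subst c(2)[of x], subst c(2)[of y]) (simp add: sum.distrib distrib_right)
    then have "(\<lambda>i. c i x + c i y) = (\<lambda>i. c i (x + y))"
      using c(1) by (intro uniq) auto
    then show "c j (x + y) = c j x + c j y" by metis
  next
    fix x y assume "\<forall>j<n. c j x = c j y"
    then have "(\<Sum>i<n. of_int (c i x) * b i) = (\<Sum>i<n. of_int (c i y) * b i)" by simp
    then show "x = y" using c(2)[of x] c(2)[of y] by simp
  qed
qed

lemma power_eventually_idempotent:
  fixes y :: "'a::monoid_mult"
  assumes "y ^ i = y ^ j" "i < j"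
  shows "\<exists>e>0. y ^ e * y ^ e = y ^ e"
proof -
  define d where "d = j - i"
  have d: "d > 0" "y ^ (i + d) = y ^ i" using assms by (simp_all add: d_def)
  have step: "y ^ (k + d) = y ^ k" if "k \<ge> i" for k
  proof -
    have "k + d = (k - i) + (i + d)" "k = (k - i) + i" using that by simp_all
    then show ?thesis using d(2) by (metis power_add)
  qed
  have *: "y ^ (k + t * d) = y ^ k" if "k \<ge> i" for k t
  proof (induction t)
    case (Suc t)
    have "y ^ (k + Suc t * d) = y ^ ((k + t * d) + d)" by (simp add: ac_simps)
    also have "\<dots> = y ^ k" using step[of "k + t * d"] that Suc by simp
    finally show ?case .
  qed simp
  \<comment> \<open>The exponent is a multiple of the period, at least \<open>i\<close>, and
    positive even when \<open>i = 0\<close>.\<close>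
  have "i \<le> Suc i * d" using d(1) by (cases d) auto
  then have "y ^ (Suc i * d + Suc i * d) = y ^ (Suc i * d)" by (rule *)
  then show ?thesis using d(1) by (intro exI[of _ "Suc i * d"] conjI) (simp, simp only: power_add)
qed

lemma connected_nontrivial:
  assumes "is_connected TYPE('r::comm_ring_1)" shows "(1::'r::comm_ring_1) \<noteq> 0"
proof
  assume *: "(1::'r) = 0"
  have "x = 0" for x :: 'r using mult_1[of x] unfolding * by simp
  then have "{e::'r. e * e = e} = {0}" by auto
  then show False using assms by (simp add: is_connected_def)
qed

lemma connected_idempotent:
  assumes "is_connected TYPE('r::comm_ring_1)" "(e::'r::comm_ring_1) * e = e"
  shows "e = 0 \<or> e = 1"
proof -
  let ?I = "{e::'r. e * e = e}"
  have "card ?I = 2" using assms(1) by (simp add: is_connected_def)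
  moreover then have "finite ?I" by (intro card_ge_0_finite) simp
  moreover have "card {0, 1::'r} = 2" using connected_nontrivial[OF assms(1)] by auto
  ultimately have "{0, 1} = ?I" by (intro card_subset_eq) auto
  then show ?thesis using assms(2) by blast
qed

text \<open>Repetition among the powers produces an idempotent power; reducedness keeps it from
  being 0, and connectedness leaves only 1.\<close>

lemma periodic_power_root_of_unity:
  assumes "is_reduced TYPE('r::comm_ring_1)" "is_connected TYPE('r::comm_ring_1)"
    and "(y::'r::comm_ring_1) ^ i = y ^ j" "i < j" "y \<noteq> 0"
  shows "\<exists>e>0. y ^ e = 1"
proof -
  obtain e where e: "e > 0" "y ^ e * y ^ e = y ^ e"
    using power_eventually_idempotent[OF assms(3,4)] by blast
  moreover have "y ^ e \<noteq> 0" using assms(1,5) by (auto simp: is_reduced_def)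
  ultimately show ?thesis using connected_idempotent[OF assms(2) e(2)] by blast
qed

section \<open>Homogeneity of roots of unity\<close>

text \<open>These maps are the linear functionals on R \<otimes> C.\<close>

definition additive_fun :: "('r::comm_ring_1 \<Rightarrow> complex) \<Rightarrow> bool" where
  "additive_fun l \<longleftrightarrow> (\<forall>x y. l (x + y) = l x + l y)"

lemma additive_fun_add: "additive_fun l \<Longrightarrow> l (x + y) = l x + l y"
  by (simp add: additive_fun_def)

lemma additive_fun_zero: "additive_fun l \<Longrightarrow> l 0 = 0"
  using additive_fun_add[of l 0 0] by simp

lemma additive_fun_sum: "additive_fun l \<Longrightarrow> l (\<Sum>i\<in>I. x i) = (\<Sum>i\<in>I. l (x i))"
  by (induction I rule: infinite_finite_induct) (simp_all add: additive_fun_add additive_fun_zero)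

locale circle_graded_ring = graded_ring circle Rd for Rd :: "complex \<Rightarrow> 'r::comm_ring_1 set"
begin

text \<open>\<open>twist a y\<close> is the transpose of multiplication by \<open>\<Sum>\<^sub>w w\<^sup>a y\<^sub>w\<close>; working with functionals on
  \<open>R\<close> avoids constructing \<open>R \<otimes> \<complex>\<close>.\<close>
definition twist :: "nat \<Rightarrow> 'r \<Rightarrow> ('r \<Rightarrow> complex) \<Rightarrow> 'r \<Rightarrow> complex" where
  "twist a y l x = (\<Sum>w\<in>supp y. w ^ a * l (cmp y w * x))"

lemma twist_superset:
  assumes "additive_fun l" "finite W" "supp y \<subseteq> W" "W \<subseteq> roots_of_unity"
  shows "twist a y l x = (\<Sum>w\<in>W. w ^ a * l (cmp y w * x))"
  unfolding twist_def using assms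
  by (intro sum.mono_neutral_left) (auto simp: supp_def additive_fun_zero)

lemma additive_twist:
  assumes "additive_fun l" shows "additive_fun (twist a y l)"
  by (simp add: additive_fun_def twist_def distrib_left additive_fun_add[OF assms] sum.distrib)

lemma twist_zero: "additive_fun l \<Longrightarrow> twist a 0 l x = 0"
  using twist_superset[of l "{}" 0 a x] by (simp add: supp_def cmp_zero)

lemma twist_add:
  assumes l: "additive_fun l"
  shows "twist a (y + z) l x = twist a y l x + twist a z l x"
proof -
  let ?W = "supp y \<union> supp z"
  have W: "finite ?W" "?W \<subseteq> roots_of_unity"
    using finite_supp supp_carrier by simp_all
  have "supp (y + z) \<subseteq> ?W" by (auto simp: supp_def cmp_add)
  then have "twist a (y + z) l x = (\<Sum>w\<in>?W. w ^ a * l (cmp (y + z) w * x))"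
    using W by (intro twist_superset l)
  also have "\<dots> = (\<Sum>w\<in>?W. w ^ a * l (cmp y w * x) + w ^ a * l (cmp z w * x))"
  proof (intro sum.cong refl)
    fix w assume "w \<in> ?W"
    then have "cmp (y + z) w * x = cmp y w * x + cmp z w * x"
      by (auto simp: supp_def cmp_add distrib_right)
    then show "w ^ a * l (cmp (y + z) w * x) = w ^ a * l (cmp y w * x) + w ^ a * l (cmp z w * x)"
      by (simp add: additive_fun_add[OF l] distrib_left)
  qed
  also have "\<dots> = twist a y l x + twist a z l x"
    using W by (simp add: sum.distrib twist_superset[OF l, of ?W])
  finally show ?thesis .
qed

lemma twist_sum: "additive_fun l \<Longrightarrow> twist a (\<Sum>i\<in>I. y i) l x = (\<Sum>i\<in>I. twist a (y i) l x)"
  by (induction I rule: infinite_finite_induct) (simp_all add: twist_add twist_zero)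

lemma twist_homogeneous:
  assumes l: "additive_fun l" and w: "w \<in> roots_of_unity" "y \<in> Rd w"
  shows "twist a y l x = w ^ a * l (y * x)"
proof -
  have "supp y \<subseteq> {w}" using w by (auto simp: supp_def cmp_homogeneous split: if_splits)
  then have "twist a y l x = (\<Sum>w\<in>{w}. w ^ a * l (cmp y w * x))"
    using w by (intro twist_superset l) auto
  then show ?thesis using w by (simp add: cmp_homogeneous)
qed

lemma twist_one: "additive_fun l \<Longrightarrow> twist a 1 l = l"
  using twist_homogeneous[of l 1 1 a] one_in by (simp add: fun_eq_iff roots_of_unity_1)

text \<open>The weights w \<mapsto> \<open>w ^ a\<close> form a character and degrees multiply, so
  weighting the components by them respects products. Commutativity of the ring keeps transposition
  from reversing the order.\<close>

lemma twist_mult: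
  assumes l: "additive_fun l"
  shows "twist a (y * z) l = twist a y (twist a z l)"
proof
  fix x
  have "y * z = (\<Sum>w\<in>supp y. \<Sum>v\<in>supp z. cmp y w * cmp z v)"
    by (simp add: sum_product[symmetric] sum_cmp)
  then have "twist a (y * z) l x = (\<Sum>w\<in>supp y. \<Sum>v\<in>supp z. twist a (cmp y w * cmp z v) l x)"
    by (simp only: twist_sum[OF l])
  also have "\<dots> = (\<Sum>w\<in>supp y. \<Sum>v\<in>supp z. (w * v) ^ a * l (cmp y w * cmp z v * x))"
  proof (intro sum.cong refl twist_homogeneous[OF l])
    fix w v assume "w \<in> supp y" "v \<in> supp z"
    then have "w \<in> roots_of_unity" "v \<in> roots_of_unity" using supp_carrier by auto
    then show "w * v \<in> roots_of_unity" "cmp y w * cmp z v \<in> Rd (w * v)"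
      using Rd_mult[of w v] cmp_in by (auto intro: roots_of_unity_mult)
  qed
  also have "\<dots> = twist a y (twist a z l) x"
    by (simp add: twist_def sum_distrib_left power_mult_distrib ac_simps)
  finally show "twist a (y * z) l x = twist a y (twist a z l) x" .
qed

lemma twist_power: "additive_fun l \<Longrightarrow> twist a (y ^ k) l = (twist a y ^^ k) l"
proof (induction k arbitrary: l)
  case (Suc k)
  then show ?case by (simp add: twist_mult)
qed (simp add: twist_one)

lemma twist_commute: "twist a y (twist b z l) = twist b z (twist a y l)"
proof
  fix x
  have "twist a y (twist b z l) x = (\<Sum>w\<in>supp y. \<Sum>v\<in>supp z. w ^ a * (v ^ b * l (cmp z v * (cmp y w * x))))"
    by (simp add: twist_def sum_distrib_left)
  also have "\<dots> = (\<Sum>v\<in>supp z. \<Sum>w\<in>supp y. w ^ a * (v ^ b * l (cmp z v * (cmp y w * x))))"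
    by (rule sum.swap)
  also have "\<dots> = twist b z (twist a y l) x"
    by (simp add: twist_def sum_distrib_left ac_simps)
  finally show "twist a y (twist b z l) x = twist b z (twist a y l) x" .
qed

text \<open>Finite Fourier inversion: the exponents \<open>a < m\<close> run over the characters of
  the group of \<open>m\<close>-th roots of unity, and summing against the inverse powers of
  \<open>w\<close> kills every degree except \<open>w\<close>.\<close>

lemma twist_average:
  assumes l: "additive_fun l" and m: "w ^ m = 1" "\<And>v. v \<in> supp y \<Longrightarrow> v ^ m = 1"
    and w: "w \<in> roots_of_unity"
  shows "(\<Sum>a<m. inverse w ^ a * twist a y l x) = of_nat m * l (cmp y w * x)"
proof -
  \<comment> \<open>The claim also covers degrees \<open>w\<close> outside the support, where both
    sides are 0.\<close>
  let ?W = "insert w (supp y)"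
  have w0: "w \<noteq> 0" using w by (rule roots_of_unity_nonzero)
  have "(\<Sum>a<m. inverse w ^ a * twist a y l x)
      = (\<Sum>a<m. \<Sum>v\<in>?W. inverse w ^ a * (v ^ a * l (cmp y v * x)))"
    using w finite_supp supp_carrier
    by (subst twist_superset[OF l, of ?W]) (auto simp: sum_distrib_left)
  also have "\<dots> = (\<Sum>v\<in>?W. \<Sum>a<m. inverse w ^ a * (v ^ a * l (cmp y v * x)))"
    by (rule sum.swap)
  also have "\<dots> = (\<Sum>v\<in>?W. (\<Sum>a<m. (v / w) ^ a) * l (cmp y v * x))"
    by (intro sum.cong refl, subst sum_distrib_right, intro sum.cong refl)
      (simp add: divide_inverse power_mult_distrib ac_simps)
  also have "\<dots> = (\<Sum>v\<in>?W. if v = w then of_nat m * l (cmp y v * x) else 0)"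
  proof (intro sum.cong refl)
    fix v assume "v \<in> ?W"
    then have "(v / w) ^ m = 1" using m by (auto simp: power_divide)
    then have "(\<Sum>a<m. (v / w) ^ a) = (if v / w = 1 then of_nat m else 0)"
      by (rule sum_powers_root_of_unity)
    then show "(\<Sum>a<m. (v / w) ^ a) * l (cmp y v * x) = (if v = w then of_nat m * l (cmp y v * x) else 0)"
      using w0 by (simp add: divide_eq_1_iff)
  qed
  also have "\<dots> = of_nat m * l (cmp y w * x)"
    using finite_supp by (simp add: sum.delta)
  finally show ?thesis .
qed

text \<open>Twisting is multiplicative, so \<open>z ^ N = 1\<close> gives every twist by
  \<open>z\<close> the period \<open>N\<close>; since twists commute, the orbit of \<open>l\<close>
  is finite.\<close>

lemma finite_twist_closed:
  assumes z: "z ^ N = 1" "N > 0" and l: "additive_fun l"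
  shows "\<exists>S. finite S \<and> l \<in> S \<and> (\<forall>k\<in>S. additive_fun k) \<and> (\<forall>a<m. twist a z ` S \<subseteq> S)"
proof -
  have "\<exists>S\<subseteq>Collect additive_fun. finite S \<and> l \<in> S \<and> (\<forall>a\<in>{..<m}. twist a z ` S \<subseteq> S)"
  proof (rule finite_commuting_closure[OF finite_lessThan _ z(2)])
    show "l \<in> Collect additive_fun" using l by simp
    fix a b and k :: "'r \<Rightarrow> complex" assume "k \<in> Collect additive_fun"
    then have k: "additive_fun k" by simp
    show "twist a z k \<in> Collect additive_fun" using additive_twist[OF k] by simp
    show "twist a z (twist b z k) = twist b z (twist a z k)" by (rule twist_commute)
    show "(twist a z ^^ N) k = k"
      unfolding twist_power[OF k, symmetric] z(1) by (rule twist_one[OF k])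
  qed
  then obtain S where "S \<subseteq> Collect additive_fun" "finite S" "l \<in> S" "\<forall>a\<in>{..<m}. twist a z ` S \<subseteq> S"
    by (elim exE conjE)
  then show ?thesis by (intro exI[of _ S]) auto
qed

section \<open>Boundedness and periodicity of the powers of a component\<close>

lemma exponent_exists:
  assumes "(w::complex) \<in> roots_of_unity"
  shows "\<exists>m>0. w ^ m = 1 \<and> (\<forall>v\<in>supp y. v ^ m = 1)"
proof -
  have "insert w (supp y) \<subseteq> roots_of_unity" using assms supp_carrier by simp
  then obtain m where "m > 0" "\<forall>v\<in>insert w (supp y). v ^ m = 1"
    using common_exponent[of "insert w (supp y)"] finite_supp by auto
  then show ?thesis by auto
qed

text \<open>The induction needs all functionals of the twist-stable set \<open>S\<close> at once. By
  Fourier inversion, \<open>k\<close> at the next power is an average of values at the current power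
  of twists of \<open>k\<close>, multiplied by scalars of norm 1; these twists lie in
  \<open>S\<close> again, so the bound does not grow.\<close>

lemma bounded_component_powers:
  assumes z: "z ^ N = 1" "N > 0" and w: "w \<in> roots_of_unity" and l: "additive_fun l"
  shows "\<exists>B. \<forall>k. norm (l (cmp z w ^ k)) \<le> B"
proof -
  obtain m where m: "m > 0" "w ^ m = 1" "\<And>v. v \<in> supp z \<Longrightarrow> v ^ m = 1"
    using exponent_exists[OF w, of z] by blast
  obtain S where S: "finite S" "l \<in> S" "\<And>k. k \<in> S \<Longrightarrow> additive_fun k"
      "\<And>a k. a < m \<Longrightarrow> k \<in> S \<Longrightarrow> twist a z k \<in> S"
    using finite_twist_closed[OF z l, of m] by (auto simp: image_subset_iff)
  have norm_w: "norm (inverse w) = 1"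
  proof -
    have "norm w ^ m = 1" using m(2) by (metis norm_one norm_power)
    then have "norm w = 1" using m(1) power_eq_imp_eq_base[of "norm w" m 1] by simp
    then show ?thesis by (simp add: norm_inverse)
  qed
  \<comment> \<open>Any common bound for the values at 1, the zeroth power, would do; the sum avoids
    choosing a maximum.\<close>
  define B where "B = (\<Sum>k\<in>S. norm (k 1))"
  have "\<forall>k\<in>S. norm (k (cmp z w ^ i)) \<le> B" for i
  proof (induction i)
    case 0
    then show ?case using S(1) by (auto simp: B_def intro: member_le_sum)
  next
    case (Suc i)
    show ?case
    proof
      fix k assume k: "k \<in> S"
      let ?x = "cmp z w ^ i"
      have "real m * norm (k (cmp z w * ?x)) = norm (of_nat m * k (cmp z w * ?x))"
        by (simp add: norm_mult)
      also have "\<dots> = norm (\<Sum>a<m. inverse w ^ a * twist a z k ?x)"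
        using twist_average[OF S(3)[OF k] m(2,3) w] by simp
      also have "\<dots> \<le> (\<Sum>a<m. norm (inverse w ^ a * twist a z k ?x))" by (rule norm_sum)
      also have "\<dots> = (\<Sum>a<m. norm (twist a z k ?x))"
        by (simp only: norm_mult norm_power norm_w power_one mult_1)
      also have "\<dots> \<le> (\<Sum>a<m. B)" using Suc S(4)[OF _ k] by (intro sum_mono) auto
      finally have "real m * norm (k (cmp z w * ?x)) \<le> real m * B" by simp
      then show "norm (k (cmp z w ^ Suc i)) \<le> B" using m(1) by simp
    qed
  qed
  then show ?thesis using S(2) by blast
qed

lemma component_power_periodic:
  assumes "is_order TYPE('r)" and z: "z ^ N = 1" "N > 0" and w: "w \<in> roots_of_unity"
  shows "\<exists>i j. i < j \<and> cmp z w ^ i = cmp z w ^ j"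
proof -
  obtain n and c :: "nat \<Rightarrow> 'r \<Rightarrow> int" where
    add: "\<And>j x y. c j (x + y) = c j x + c j y" and
    inj: "\<And>x y. (\<And>j. j < n \<Longrightarrow> c j x = c j y) \<Longrightarrow> x = y"
    using order_coordinates[OF assms(1)] by blast
  have "\<exists>B. \<forall>k. norm (complex_of_int (c j (cmp z w ^ k))) \<le> B" for j
    using bounded_component_powers[OF z w, of "\<lambda>x. of_int (c j x)"] add
    by (simp add: additive_fun_def)
  then obtain B where B: "\<And>j k. norm (complex_of_int (c j (cmp z w ^ k))) \<le> B j" by metis
  \<comment> \<open>Coordinate vectors of the powers: integral and bounded, they lie in a finite
    box, so two of them coincide.\<close>
  define f where "f k = (\<lambda>j\<in>{..<n}. c j (cmp z w ^ k))" for k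
  have "f k \<in> (\<Pi>\<^sub>E j\<in>{..<n}. {- \<lceil>B j\<rceil> .. \<lceil>B j\<rceil>})" for k
  proof (rule PiE_I)
    fix j assume "j \<in> {..<n}"
    have "\<bar>c j (cmp z w ^ k)\<bar> \<le> \<lceil>B j\<rceil>" using B[of j k] by (simp add: le_ceiling_iff norm_of_int; linarith)
    then show "f k j \<in> {- \<lceil>B j\<rceil> .. \<lceil>B j\<rceil>}" using \<open>j \<in> {..<n}\<close> by (auto simp: f_def)
  qed (simp add: f_def)
  then have "range f \<subseteq> (\<Pi>\<^sub>E j\<in>{..<n}. {- \<lceil>B j\<rceil> .. \<lceil>B j\<rceil>})" by blast
  then have "finite (range f)" by (rule finite_subset) (intro finite_PiE; simp)
  then have "\<not> inj f" using finite_imageD infinite_UNIV_nat by blast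
  then obtain i j where ij: "i \<noteq> j" "f i = f j" by (auto simp: inj_def)
  then have "cmp z w ^ i = cmp z w ^ j"
    by (intro inj) (metis f_def lessThan_iff restrict_apply')
  with ij(1) show ?thesis by (metis linorder_neqE_nat)
qed

text \<open>The hypothesis says that evaluation at 1 is, on the finite set of functionals permuted by
  the twists, equal to its average over the twists; strict convexity then makes it invariant.\<close>
lemma unit_component_one:
  assumes "is_order TYPE('r)" and z: "z ^ N = 1" "N > 0" and one: "cmp z 1 = 1"
  shows "z = 1"
proof -
  obtain n and c :: "nat \<Rightarrow> 'r \<Rightarrow> int" where
    add: "\<And>j x y. c j (x + y) = c j x + c j y" and
    inj: "\<And>x y. (\<And>j. j < n \<Longrightarrow> c j x = c j y) \<Longrightarrow> x = y"
    using order_coordinates[OF assms(1)] by blast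
  obtain m where m: "m > 0" "\<And>v. v \<in> supp z \<Longrightarrow> v ^ m = 1"
    using exponent_exists[OF roots_of_unity_1, of z] by blast
  show ?thesis
  proof (rule inj)
    fix j
    define l where "l x = complex_of_int (c j x)" for x
    have l: "additive_fun l" using add by (simp add: additive_fun_def l_def)
    obtain S where S: "finite S" "l \<in> S" "\<And>k. k \<in> S \<Longrightarrow> additive_fun k"
      "\<And>a. a < m \<Longrightarrow> twist a z ` S \<subseteq> S"
      using finite_twist_closed[OF z l, of m] by blast
    \<comment> \<open>Squares are to be compared, so only real parts are used; this loses nothing
      for the integer-valued \<open>l\<close>.\<close>
    define r where "r k = Re (k 1)" for k :: "'r \<Rightarrow> complex"
    have perm: "bij_betw (twist a z) S S" if "a < m" for a
    proof -
      have "inj_on (twist a z) S"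
      proof (rule inj_onI)
        fix k k' assume k: "k \<in> S" "k' \<in> S" "twist a z k = twist a z k'"
        have "twist a (z ^ (N - 1)) (twist a z h) = h" if "h \<in> S" for h
          using S(3)[OF that] z by (simp add: twist_mult[symmetric] power_Suc2[symmetric] twist_one del: power_Suc)
        then show "k = k'" using k by metis
      qed
      then show ?thesis using S(1) S(4)[OF that] by (simp add: bij_betw_def endo_inj_surj)
    qed
    \<comment> \<open>Fourier inversion in degree 1, evaluated at 1. The component there is 1 by
      hypothesis, so \<open>r k\<close> is the mean of its values at the twists of
      \<open>k\<close>.\<close>
    have avg: "(\<Sum>a<m. r (twist a z k)) = real m * r k" if "k \<in> S" for k
      using arg_cong[OF twist_average[OF S(3)[OF that], of 1 m z 1], of Re] m one roots_of_unity_1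
      by (simp add: r_def)
    \<comment> \<open>The total squared deviation is computed to be 0: each twist permutes
      \<open>S\<close>, so the square terms have equal sums, and \<open>avg\<close> evaluates the
      cross terms to the same amount.\<close>
    have "(\<Sum>a<m. \<Sum>k\<in>S. (r (twist a z k) - r k)\<^sup>2)
        = (\<Sum>a<m. (\<Sum>k\<in>S. (r (twist a z k))\<^sup>2) + (\<Sum>k\<in>S. (r k)\<^sup>2) - 2 * (\<Sum>k\<in>S. r k * r (twist a z k)))"
      by (simp add: power2_diff sum.distrib sum_subtractf sum_distrib_left ac_simps)
    also have "\<dots> = (\<Sum>a<m. 2 * (\<Sum>k\<in>S. (r k)\<^sup>2) - 2 * (\<Sum>k\<in>S. r k * r (twist a z k)))"
    proof (intro sum.cong refl)
      fix a assume "a \<in> {..<m}"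
      then have "(\<Sum>k\<in>S. (r (twist a z k))\<^sup>2) = (\<Sum>k\<in>S. (r k)\<^sup>2)"
        using sum.reindex_bij_betw[OF perm, of a "\<lambda>k. (r k)\<^sup>2"] by simp
      then show "(\<Sum>k\<in>S. (r (twist a z k))\<^sup>2) + (\<Sum>k\<in>S. (r k)\<^sup>2) - 2 * (\<Sum>k\<in>S. r k * r (twist a z k))
          = 2 * (\<Sum>k\<in>S. (r k)\<^sup>2) - 2 * (\<Sum>k\<in>S. r k * r (twist a z k))" by simp
    qed
    also have "\<dots> = real m * (2 * (\<Sum>k\<in>S. (r k)\<^sup>2)) - 2 * (\<Sum>a<m. \<Sum>k\<in>S. r k * r (twist a z k))"
      by (simp add: sum_subtractf sum_distrib_left)
    also have "(\<Sum>a<m. \<Sum>k\<in>S. r k * r (twist a z k)) = (\<Sum>k\<in>S. r k * (\<Sum>a<m. r (twist a z k)))"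
      by (subst sum.swap) (simp add: sum_distrib_left)
    also have "\<dots> = (\<Sum>k\<in>S. r k * (real m * r k))"
      using avg by (intro sum.cong) auto
    also have "\<dots> = real m * (\<Sum>k\<in>S. (r k)\<^sup>2)"
      by (simp add: sum_distrib_left power2_eq_square ac_simps)
    finally have "(\<Sum>a<m. \<Sum>k\<in>S. (r (twist a z k) - r k)\<^sup>2) = 0" by simp
    then have "\<forall>a\<in>{..<m}. (\<Sum>k\<in>S. (r (twist a z k) - r k)\<^sup>2) = 0"
      by (subst (asm) sum_nonneg_eq_0_iff) (auto intro: sum_nonneg)
    then have "(\<Sum>k\<in>S. (r (twist 0 z k) - r k)\<^sup>2) = 0" using m(1) by blast
    then have "(r (twist 0 z l) - r l)\<^sup>2 = 0"
      using S(1,2) by (subst (asm) sum_nonneg_eq_0_iff) auto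
    \<comment> \<open>For exponent 0 all weights are 1, so the twist is the transpose of
      multiplication by \<open>z\<close> itself. Invariance of the value at 1 now compares
      \<open>z\<close> with 1.\<close>
    moreover have "twist 0 z l 1 = l z"
      using additive_fun_sum[OF l, of "cmp z" "supp z"] by (simp add: twist_def sum_cmp)
    ultimately show "c j z = c j 1" by (simp add: r_def l_def)
  qed
qed

lemma root_of_unity_homogeneous_circle:
  assumes R: "is_order TYPE('r)" "is_reduced TYPE('r)" "is_connected TYPE('r)"
    and "z \<in> roots_of_unity"
  shows "\<exists>w\<in>roots_of_unity. z \<in> Rd w"
proof -
  obtain N where N: "N > 0" "z ^ N = 1" using assms(4) by (auto simp: roots_of_unity_def)
  have "z \<noteq> 0" using N connected_nontrivial[OF R(3)] by (auto simp: power_0_left)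
  then have "supp z \<noteq> {}" using sum_cmp[of z] by auto
  then obtain w where w: "w \<in> roots_of_unity" "cmp z w \<noteq> 0" by (auto simp: supp_def)
  let ?y = "cmp z w"
  obtain i j where "i < j" "?y ^ i = ?y ^ j"
    using component_power_periodic[OF R(1) N(2,1) w(1)] by blast
  then obtain e where e: "e > 0" "?y ^ e = 1"
    using periodic_power_root_of_unity[OF R(2,3)] w(2) by blast
  have yw: "?y \<in> Rd w" using w(1) by (simp add: cmp_in)
  have pow_in: "?y ^ k \<in> Rd (w ^ k)" for k
  proof (induction k)
    case 0 then show ?case using one_in by simp
  next
    case (Suc k)
    then show ?case using Rd_mult[of w "w ^ k" ?y "?y ^ k"] w(1) yw by (simp add: roots_of_unity_power)
  qed
  have "1 \<in> Rd (w ^ e)" using pow_in[of e] e(2) by simp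
  \<comment> \<open>The nonzero element 1 has a single degree. Hence \<open>w ^ (e - 1)\<close> is
    inverse to \<open>w\<close>, just as \<open>?u\<close> below is inverse to
    \<open>?y\<close>.\<close>
  then have "w ^ e = 1"
    using degree_unique[of "w ^ e" 1 1] one_in w(1) connected_nontrivial[OF R(3)]
    by (simp add: roots_of_unity_power roots_of_unity_1)
  let ?u = "?y ^ (e - 1)"
  have "?u * ?y = 1" "w ^ (e - 1) * w = 1"
    unfolding power_minus_mult[OF e(1)] by fact+
  then have ye: "?y * ?u = 1" "w * w ^ (e - 1) = 1"
    by (simp_all only: mult.commute[of ?y] mult.commute[of w])
  have "cmp (z * ?u) (w * w ^ (e - 1)) = ?y * ?u"
    using cmp_mult_homogeneous[of "w ^ (e - 1)" ?u w z] pow_in w(1) by (simp add: roots_of_unity_power)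
  then have "cmp (z * ?u) 1 = 1" by (simp only: ye)
  \<comment> \<open>The exponent is a multiple of \<open>N\<close>, which kills \<open>z\<close>,
    and of \<open>e\<close>, which kills the powers of \<open>?y\<close>.\<close>
  moreover have "(z * ?u) ^ (N * e) = 1"
  proof -
    have "z ^ (N * e) = 1" by (simp only: power_mult N(2) power_one)
    moreover have "(e - 1) * (N * e) = e * ((e - 1) * N)" by simp
    then have "?u ^ (N * e) = (?y ^ e) ^ ((e - 1) * N)"
      by (simp only: power_mult[symmetric])
    ultimately show ?thesis by (simp only: power_mult_distrib e(2) power_one mult_1)
  qed
  ultimately have "z * ?u = 1"
    using N(1) e(1) by (intro unit_component_one[OF R(1), of "z * ?u" "N * e"]) simp_all
  have "z = z * (?u * ?y)" using ye(1) by (simp only: mult.commute[of ?u] mult_1_right)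
  also have "\<dots> = ?y" by (simp only: mult.assoc[symmetric] \<open>z * ?u = 1\<close> mult_1_left)
  finally have "z = ?y" .
  then show ?thesis using w(1) yw by auto
qed

end

section \<open>Group ring decompositions as gradings\<close>

lemma is_grading_cong:
  assumes "is_grading D Rd" "\<And>d. d \<in> carrier D \<Longrightarrow> Rd d = Rd' d"
  shows "is_grading D Rd'"
proof -
  interpret graded_ring D Rd using assms(1) by (rule graded_ringI)
  have "\<forall>d\<in>carrier D. 0 \<in> Rd' d \<and> (\<forall>x\<in>Rd' d. \<forall>y\<in>Rd' d. x - y \<in> Rd' d)"
    using Rd_zero Rd_diff assms(2) by metis
  moreover have "\<forall>c\<in>carrier D. \<forall>d\<in>carrier D. \<forall>x\<in>Rd' c. \<forall>y\<in>Rd' d. x * y \<in> Rd' (c \<otimes>\<^bsub>D\<^esub> d)"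
    using Rd_mult assms(2) m_closed by metis
  moreover have "\<forall>r. \<exists>!x. x \<in> extensional (carrier D) \<and> (\<forall>d\<in>carrier D. x d \<in> Rd' d)
     \<and> finite {d\<in>carrier D. x d \<noteq> 0} \<and> r = (\<Sum>d\<in>{d\<in>carrier D. x d \<noteq> 0}. x d)"
  proof
    fix r
    have "(\<forall>d\<in>carrier D. x d \<in> Rd' d) \<longleftrightarrow> (\<forall>d\<in>carrier D. x d \<in> Rd d)" for x
      using assms(2) by simp
    then show "\<exists>!x. x \<in> extensional (carrier D) \<and> (\<forall>d\<in>carrier D. x d \<in> Rd' d)
     \<and> finite {d\<in>carrier D. x d \<noteq> 0} \<and> r = (\<Sum>d\<in>{d\<in>carrier D. x d \<noteq> 0}. x d)"
      using decomposition_ex1[of r] by (simp only:)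
  qed
  ultimately show ?thesis
    unfolding is_grading_def using comm_group_axioms by blast
qed

lemma ex1_transfer:
  assumes "\<And>a. P a \<Longrightarrow> Q (t a)" "\<And>x. Q x \<Longrightarrow> P (u x)"
    and "\<And>a. P a \<Longrightarrow> u (t a) = a" "\<And>x. Q x \<Longrightarrow> t (u x) = x"
  shows "(\<exists>!a. P a) \<longleftrightarrow> (\<exists>!x. Q x)"
  using assms by metis

text \<open>Elements of \<open>H\<close> are units, so a coefficient a(h) and the component a(h)h
  determine each other and vanish together.\<close>

lemma group_ring_iso_iff_decomposition:
  assumes H: "is_unit_subgroup H"
  shows "group_ring_iso A H \<longleftrightarrow> (\<forall>r. \<exists>!x. x \<in> extensional H \<and> (\<forall>h\<in>H. x h \<in> (\<lambda>a. a * h) ` A)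
     \<and> finite {h\<in>H. x h \<noteq> 0} \<and> r = (\<Sum>h\<in>{h\<in>H. x h \<noteq> 0}. x h))"
proof -
  obtain v where v: "\<And>h. h \<in> H \<Longrightarrow> h * v h = 1"
    using H unfolding is_unit_subgroup_def by metis
  then have cancel: "a * h * v h = a" "a * v h * h = a" if "h \<in> H" for a h
    using that by (metis mult.assoc mult.commute mult.right_neutral)+
  have zero: "a * h = 0 \<longleftrightarrow> a = 0" if "h \<in> H" for a h
    using cancel(1)[OF that, of a] by auto
  show ?thesis
    unfolding group_ring_iso_def
  proof (intro all_cong1 ex1_transfer[where t = "\<lambda>a. \<lambda>h\<in>H. a h * h" and u = "\<lambda>x. \<lambda>h\<in>H. x h * v h"])
    fix r a
    assume a: "a \<in> H \<rightarrow>\<^sub>E A \<and> finite {g\<in>H. a g \<noteq> 0} \<and> r = (\<Sum>g\<in>{g\<in>H. a g \<noteq> 0}. a g * g)"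
    have set_eq: "{h\<in>H. (\<lambda>h\<in>H. a h * h) h \<noteq> 0} = {g\<in>H. a g \<noteq> 0}"
      using zero by auto
    show "(\<lambda>h\<in>H. a h * h) \<in> extensional H \<and> (\<forall>h\<in>H. (\<lambda>h\<in>H. a h * h) h \<in> (\<lambda>a. a * h) ` A)
     \<and> finite {h\<in>H. (\<lambda>h\<in>H. a h * h) h \<noteq> 0} \<and> r = (\<Sum>h\<in>{h\<in>H. (\<lambda>h\<in>H. a h * h) h \<noteq> 0}. (\<lambda>h\<in>H. a h * h) h)"
      unfolding set_eq
    proof (intro conjI ballI)
      show "r = (\<Sum>h\<in>{g\<in>H. a g \<noteq> 0}. (\<lambda>h\<in>H. a h * h) h)"
        using conjunct2[OF conjunct2[OF a]] by (auto intro: trans sum.cong)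
    qed (use a in auto)
    show "(\<lambda>h\<in>H. (\<lambda>h\<in>H. a h * h) h * v h) = a"
      using conjunct1[OF a] cancel(1) by (intro extensionalityI[of _ H]) (auto simp: PiE_def)
  next
    fix r x
    assume x: "x \<in> extensional H \<and> (\<forall>h\<in>H. x h \<in> (\<lambda>a. a * h) ` A)
     \<and> finite {h\<in>H. x h \<noteq> 0} \<and> r = (\<Sum>h\<in>{h\<in>H. x h \<noteq> 0}. x h)"
    have nz: "x h * v h = 0 \<longleftrightarrow> x h = 0" if "h \<in> H" for h
      using cancel(2)[OF that, of "x h"] by auto
    have set_eq: "{h\<in>H. (\<lambda>h\<in>H. x h * v h) h \<noteq> 0} = {h\<in>H. x h \<noteq> 0}"
      using nz by auto
    have "x h * v h \<in> A" if "h \<in> H" for h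
      using x cancel(1)[OF that] that by auto
    then show "(\<lambda>h\<in>H. x h * v h) \<in> H \<rightarrow>\<^sub>E A \<and> finite {g\<in>H. (\<lambda>h\<in>H. x h * v h) g \<noteq> 0}
       \<and> r = (\<Sum>g\<in>{g\<in>H. (\<lambda>h\<in>H. x h * v h) g \<noteq> 0}. (\<lambda>h\<in>H. x h * v h) g * g)"
      unfolding set_eq using x cancel(2)
      by (intro conjI) (auto intro!: sum.cong elim!: trans)
    show "(\<lambda>h\<in>H. (\<lambda>h\<in>H. x h * v h) h * h) = x"
      using x cancel(2) by (intro extensionalityI[of _ H]) auto
  qed
qed

text \<open>The dictionary for \<open>DR\<close>: a decomposition is a grading by \<open>H\<close>
  whose piece over each \<open>h\<close> is the translate of \<open>A\<close> by
  \<open>h\<close>.\<close>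

lemma is_grading_mult_group_iff:
  assumes A: "is_subring A" and H: "is_unit_subgroup H"
  shows "is_grading (mult_group H) (\<lambda>h. (\<lambda>a. a * h) ` A) \<longleftrightarrow> group_ring_iso A H"
proof -
  have "0 \<in> A" using A unfolding is_subring_def by (metis diff_self)
  then have zero: "0 \<in> (\<lambda>a. a * h) ` A" for h by (intro image_eqI[of _ _ 0]) simp_all
  have diff: "x - y \<in> (\<lambda>a. a * h) ` A" if xy: "x \<in> (\<lambda>a. a * h) ` A" "y \<in> (\<lambda>a. a * h) ` A" for x y h
  proof -
    obtain a b where "a \<in> A" "b \<in> A" "x = a * h" "y = b * h" using xy by auto
    then show ?thesis using A by (intro image_eqI[of _ _ "a - b"]) (auto simp: is_subring_def left_diff_distrib)
  qed
  have mult: "x * y \<in> (\<lambda>a. a * (h * k)) ` A" if xy: "x \<in> (\<lambda>a. a * h) ` A" "y \<in> (\<lambda>a. a * k) ` A" for x y h k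
  proof -
    obtain a b where "a \<in> A" "b \<in> A" "x = a * h" "y = b * k" using xy by auto
    then show ?thesis using A by (intro image_eqI[of _ _ "a * b"]) (auto simp: is_subring_def ac_simps)
  qed
  show ?thesis
    unfolding is_grading_def group_ring_iso_iff_decomposition[OF H] mult_group_simps
    by (intro iffI conjI ballI comm_group_mult_group[OF H] zero diff mult) (elim conjE)
qed

text \<open>Needed because groups of units of R are to be used as degree groups in the countable
  form of universality.\<close>

lemma countable_order:
  assumes "is_order TYPE('r::comm_ring_1)"
  shows "countable (A :: 'r set)"
proof -
  obtain n and c :: "nat \<Rightarrow> 'r \<Rightarrow> int" where
    inj: "\<And>x y. (\<And>j. j < n \<Longrightarrow> c j x = c j y) \<Longrightarrow> x = y"
    using order_coordinates[OF assms] by blast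
  have "inj_on (\<lambda>x. map (\<lambda>j. c j x) [0..<n]) A"
    by (rule inj_onI, rule inj) simp
  then show ?thesis by (rule countable_image_inj_on[rotated]) simp
qed

section \<open>Finiteness of unit subgroups and of supports\<close>

lemma unit_subgroup_power: "is_unit_subgroup H \<Longrightarrow> h \<in> H \<Longrightarrow> h ^ k \<in> H"
  by (induction k) (auto simp: is_unit_subgroup_def)

lemma finite_unit_subgroup_roots_of_unity:
  assumes H: "is_unit_subgroup H" and "finite H"
  shows "H \<subseteq> roots_of_unity"
proof
  fix h assume h: "h \<in> H"
  have "range (\<lambda>k::nat. h ^ k) \<subseteq> H" using unit_subgroup_power[OF H h] by blast
  then have "\<not> inj (\<lambda>k::nat. h ^ k)"
    using finite_subset[OF _ \<open>finite H\<close>] finite_imageD infinite_UNIV_nat by blast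
  then obtain i j :: nat where "i \<noteq> j" "h ^ i = h ^ j" unfolding inj_def by blast
  then obtain i j :: nat where ij: "i < j" "h ^ i = h ^ j" by (metis linorder_neqE_nat)
  obtain v where v: "h * v = 1" using H h unfolding is_unit_subgroup_def by metis
  have vi: "h ^ i * v ^ i = 1" by (simp only: power_mult_distrib[symmetric] v power_one)
  have "h ^ (j - i) * h ^ i = h ^ (j - i + i)" by (simp only: power_add)
  also have "\<dots> = h ^ i" using ij by simp
  finally have "h ^ (j - i) * h ^ i = h ^ i" .
  then have "h ^ (j - i) * (h ^ i * v ^ i) = h ^ i * v ^ i" by (simp only: mult.assoc[symmetric])
  then have "h ^ (j - i) = 1" by (simp only: vi mult_1_right)
  then show "h \<in> roots_of_unity" unfolding roots_of_unity_def using ij(1) by (intro CollectI exI[of _ "j - i"]) simp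
qed

context graded_ring
begin

lemma of_nat_in: "of_nat k \<in> Rd \<one>"
  by (induction k) (auto intro: Rd_zero Rd_add one_in)

lemma of_int_in: "of_int k \<in> Rd \<one>"
proof (cases k)
  case (nonneg n) then show ?thesis using of_nat_in by simp
next
  case (neg n) then show ?thesis using Rd_diff[OF one_closed Rd_zero of_nat_in[of "Suc n"]] by simp
qed

text \<open>Integers have degree \<one>, so multiplying by them cannot enlarge a support; the
  supports of a finite Z-basis therefore bound all others.\<close>

lemma finite_support:
  assumes "is_order TYPE('r)"
  shows "\<exists>W. finite W \<and> (\<forall>r. supp r \<subseteq> W)"
proof -
  obtain n and b :: "nat \<Rightarrow> 'r" where
    "\<And>r. \<exists>!c::nat \<Rightarrow> int. (\<forall>i\<ge>n. c i = 0) \<and> r = (\<Sum>i<n. of_int (c i) * b i)"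
    using assms unfolding is_order_def by blast
  then have b: "\<exists>c::nat \<Rightarrow> int. r = (\<Sum>i<n. of_int (c i) * b i)" for r by blast
  have "supp r \<subseteq> (\<Union>i<n. supp (b i))" for r
  proof
    fix d assume "d \<in> supp r"
    then have d: "d \<in> carrier D" "cmp r d \<noteq> 0" by (auto simp: supp_def)
    obtain c where c: "r = (\<Sum>i<n. of_int (c i) * b i)" using b by blast
    have "cmp r d = (\<Sum>i<n. cmp (of_int (c i) * b i) d)" unfolding c by (rule cmp_sum[OF d(1)])
    with d(2) have "(\<Sum>i<n. cmp (of_int (c i) * b i) d) \<noteq> 0" by simp
    then obtain i where i: "i \<in> {..<n}" "cmp (of_int (c i) * b i) d \<noteq> 0"
      by (rule sum.not_neutral_contains_not_neutral)
    have "cmp (b i * of_int (c i)) (d \<otimes> \<one>) = cmp (b i) d * of_int (c i)"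
      using d(1) by (intro cmp_mult_homogeneous of_int_in) auto
    then have "cmp (b i) d \<noteq> 0" using i(2) d(1) by (auto simp: mult.commute)
    then show "d \<in> (\<Union>i<n. supp (b i))" using i(1) d(1) by (auto simp: supp_def)
  qed
  then show ?thesis using finite_supp by (intro exI[of _ "\<Union>i<n. supp (b i)"]) auto
qed

lemma root_of_unity_homogeneous:
  assumes R: "is_order TYPE('r)" "is_reduced TYPE('r)" "is_connected TYPE('r)"
    and z: "z \<in> roots_of_unity"
  shows "\<exists>g\<in>carrier D. z \<in> Rd g"
proof -
  have eq: "c = d" if cd: "c \<in> supp z" "d \<in> supp z" for c d
  proof (rule ccontr)
    assume "c \<noteq> d"
    have cdD: "c \<in> carrier D" "d \<in> carrier D" using cd supp_carrier by auto
    then have "c \<otimes> inv d \<noteq> \<one>" using \<open>c \<noteq> d\<close> by (metis inv_closed inv_equality inv_inv)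
    then obtain \<chi> where \<chi>: "\<chi> \<in> hom D circle" "\<chi> (c \<otimes> inv d) \<noteq> 1"
      using exists_separating_character[of "{\<one>}" "c \<otimes> inv d"] cdD triv_subgroup by auto
    \<comment> \<open>Coarsening along \<open>\<chi>\<close> keeps \<open>c\<close> and
      \<open>d\<close> in different degrees, whereas homogeneity of \<open>z\<close> in the coarser
      grading puts all of its support into one fibre.\<close>
    interpret C: circle_graded_ring "\<lambda>w. graded_span Rd {g\<in>carrier D. \<chi> g = w}"
      unfolding circle_graded_ring_def
      by (rule graded_ringI) (rule pushforward_grading[OF comm_group_circle \<chi>(1)])
    obtain w where w: "w \<in> roots_of_unity" "z \<in> graded_span Rd {g\<in>carrier D. \<chi> g = w}"
      using C.root_of_unity_homogeneous_circle[OF R z] by blast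
    have "supp z \<subseteq> {g\<in>carrier D. \<chi> g = w}"
      by (rule graded_span_iff[THEN iffD1, OF _ w(2)]) blast
    then have "\<chi> c = w" "\<chi> d = w" using cd by auto
    moreover have "\<chi> c = \<chi> (c \<otimes> inv d) * \<chi> d"
      using hom_mult[OF \<chi>(1), of "c \<otimes> inv d" d] cdD by (simp add: m_assoc)
    ultimately show False using \<chi>(2) w(1) roots_of_unity_nonzero by auto
  qed
  show ?thesis
  proof (cases "supp z = {}")
    case True
    then show ?thesis using sum_cmp[of z] Rd_zero by (intro bexI[of _ \<one>]) auto
  next
    case False
    then obtain g where "g \<in> supp z" by blast
    then have "supp z = {g}" using eq by blast
    then have "z \<in> graded_span Rd {g}" "g \<in> carrier D" using supp_carrier[of z] by (auto simp: graded_span_iff)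
    then show ?thesis by (auto simp: graded_span_singleton)
  qed
qed

end

section \<open>The isomorphism\<close>

locale universally_graded_order =
  fixes G :: "'g monoid" (structure) and Rd :: "'g \<Rightarrow> 'r::comm_ring_1 set"
  assumes order: "is_order TYPE('r)" and reduced: "is_reduced TYPE('r)"
    and connected: "is_connected TYPE('r)" and universal: "universal_grading G Rd"
begin

sublocale graded_ring G Rd
  by (rule graded_ringI) (use universal in \<open>simp add: universal_grading_def\<close>)

abbreviation d :: "'r \<Rightarrow> 'g" where "d \<equiv> deg G Rd"

section \<open>The degree map on roots of unity\<close>

lemma root_of_unity_not_zero: "z \<in> roots_of_unity \<Longrightarrow> z \<noteq> (0::'r)"
  using connected_nontrivial[OF connected] by (auto simp: roots_of_unity_def power_0_left)

lemma deg_eqI: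
  assumes "g \<in> carrier G" "z \<in> Rd g" "z \<noteq> 0" shows "d z = g"
  unfolding deg_def
proof (rule the_equality)
  fix c assume "c \<in> carrier G \<and> z \<in> Rd c"
  then show "c = g" by (elim conjE) (rule degree_unique[OF _ assms(1) _ assms(2,3)])
qed (use assms in simp)

lemma deg_in:
  assumes "z \<in> roots_of_unity" shows "d z \<in> carrier G" "z \<in> Rd (d z)"
proof -
  obtain g where "g \<in> carrier G" "z \<in> Rd g"
    using root_of_unity_homogeneous[OF order reduced connected assms] by blast
  with deg_eqI[OF this root_of_unity_not_zero[OF assms]] show "d z \<in> carrier G" "z \<in> Rd (d z)"
    by simp_all
qed

lemma supp_root_of_unity:
  assumes "z \<in> roots_of_unity" shows "supp z = {d z}"
  using deg_in[OF assms] root_of_unity_not_zero[OF assms] cmp_homogeneous[OF deg_in[OF assms]]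
  by (auto simp: supp_def split: if_splits)

lemma deg_mult:
  assumes "x \<in> roots_of_unity" "y \<in> roots_of_unity"
  shows "d (x * y) = d x \<otimes> d y"
  using root_of_unity_not_zero[OF roots_of_unity_mult[OF assms]]
  by (intro deg_eqI Rd_mult m_closed deg_in assms)

lemma deg_one: "d 1 = \<one>"
  using one_in connected_nontrivial[OF connected] by (intro deg_eqI) auto

text \<open>A pushforward depends only on the values at degrees with a nonzero piece, so
  \<open>f\<close> and \<open>h\<close> induce the same grading by \<open>E\<close>, and uniqueness
  in the universal property identifies them on the whole group.\<close>

lemma hom_eq_on_support:
  assumes E: "comm_group E" "countable (carrier E)" and f: "f \<in> hom G E" and h: "h \<in> hom G E"
    and eq: "\<And>g x. g \<in> carrier G \<Longrightarrow> x \<in> Rd g \<Longrightarrow> x \<noteq> 0 \<Longrightarrow> f g = h g"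
    and g: "g \<in> carrier G"
  shows "f g = h g"
proof -
  define R' where "R' = (\<lambda>e. graded_span Rd {g\<in>carrier G. f g = e})"
  have ex1: "\<exists>!f. f \<in> hom G E \<and> f \<in> extensional (carrier G) \<and>
      (\<forall>e\<in>carrier E. R' e = graded_span Rd {g\<in>carrier G. f g = e})"
    unfolding R'_def by (intro universal_grading_countable[OF universal _ E(2)] pushforward_grading[OF E(1) f])
  have on_supp: "f c = h c" if "c \<in> supp r" for r c
    using that eq[of c "cmp r c"] by (auto simp: supp_def cmp_in)
  have span_eq: "graded_span Rd {g\<in>carrier G. f g = e} = graded_span Rd {g\<in>carrier G. h g = e}" for e
  proof (rule Set.set_eqI)
    fix r
    have "supp r \<subseteq> {g\<in>carrier G. f g = e} \<longleftrightarrow> supp r \<subseteq> {g\<in>carrier G. h g = e}"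
      using on_supp[of _ r] supp_carrier[of r] by auto
    then show "r \<in> graded_span Rd {g\<in>carrier G. f g = e} \<longleftrightarrow> r \<in> graded_span Rd {g\<in>carrier G. h g = e}"
      by (subst (1 2) graded_span_iff) auto
  qed
  have restr: "{g\<in>carrier G. restrict k (carrier G) g = e} = {g\<in>carrier G. k g = e}" for e and k :: "'g \<Rightarrow> 'd"
    by auto
  have hom_restr: "restrict k (carrier G) \<in> hom G E" if "k \<in> hom G E" for k
    using that by (auto simp: hom_def)
  have "restrict f (carrier G) = restrict h (carrier G)"
  proof (rule ex1E[OF ex1])
    fix k
    assume *: "\<forall>y. y \<in> hom G E \<and> y \<in> extensional (carrier G) \<and>
      (\<forall>e\<in>carrier E. R' e = graded_span Rd {g\<in>carrier G. y g = e}) \<longrightarrow> y = k"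
    have "restrict f (carrier G) = k"
      by (rule *[THEN spec, THEN mp], intro conjI ballI)
        (simp_all only: restr R'_def hom_restr[OF f] restrict_extensional)
    moreover have "restrict h (carrier G) = k"
      by (rule *[THEN spec, THEN mp], intro conjI ballI)
        (simp_all only: restr R'_def span_eq hom_restr[OF h] restrict_extensional)
    ultimately show ?thesis by simp
  qed
  then show ?thesis using g by (metis restrict_apply')
qed

text \<open>A character that is trivial on the subgroup generated by the occurring degrees agrees
  with the trivial one on the support, hence everywhere; but characters can tell a proper subgroup
  from the group.\<close>

lemma generate_support: "generate G {g\<in>carrier G. \<exists>x\<in>Rd g. x \<noteq> 0} = carrier G"
proof (rule ccontr)
  let ?S = "{g\<in>carrier G. \<exists>x\<in>Rd g. x \<noteq> 0}"
  assume "generate G ?S \<noteq> carrier G"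
  moreover have "generate G ?S \<subseteq> carrier G" by (rule generate_incl) auto
  ultimately obtain g where g: "g \<in> carrier G" "g \<notin> generate G ?S" by blast
  have sub: "subgroup (generate G ?S) G" by (rule generate_is_subgroup) auto
  obtain \<chi> where \<chi>: "\<chi> \<in> hom G circle" "\<forall>x\<in>generate G ?S. \<chi> x = 1" "\<chi> g \<noteq> 1"
    using exists_separating_character[OF sub g] by blast
  have "\<chi> g = (\<lambda>_. 1) g"
  proof (rule hom_eq_on_support[OF comm_group_circle countable_circle \<chi>(1) _ _ g(1)])
    show "(\<lambda>_. 1) \<in> hom G circle" by (auto simp: hom_def roots_of_unity_1)
    fix c and x :: 'r assume "c \<in> carrier G" "x \<in> Rd c" "x \<noteq> 0"
    then have "c \<in> generate G ?S" by (intro generate.incl) auto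
    then show "\<chi> c = 1" using \<chi>(2) by blast
  qed
  then show False using \<chi>(3) by simp
qed

lemma comm_group_roots: "comm_group (mult_group (roots_of_unity :: 'r set))"
  by (rule comm_group_mult_group[OF is_unit_subgroup_roots_of_unity])

section \<open>From idempotent homomorphisms to group ring decompositions and back\<close>

lemma Id0D:
  assumes "f \<in> Id0 G Rd"
  shows "\<And>g. g \<in> carrier G \<Longrightarrow> f g \<in> roots_of_unity" "f \<in> extensional (carrier G)"
    "\<And>a b. a \<in> carrier G \<Longrightarrow> b \<in> carrier G \<Longrightarrow> f (a \<otimes> b) = f a * f b"
    "\<And>g. g \<in> carrier G \<Longrightarrow> f (d (f g)) = f g"
  using assms unfolding Id0_def by (auto simp: PiE_def Pi_def)

lemma Id0_hom:
  assumes "f \<in> Id0 G Rd" shows "f \<in> hom G (mult_group roots_of_unity)"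
  using Id0D[OF assms] by (auto simp: hom_def)

lemma Id0_image_hom:
  assumes "f \<in> Id0 G Rd" shows "f \<in> hom G (mult_group (f ` carrier G))"
  using Id0D[OF assms] by (auto simp: hom_def)

lemma Id0_image_subset: "f \<in> Id0 G Rd \<Longrightarrow> f ` carrier G \<subseteq> roots_of_unity"
  using Id0D(1) by blast

lemma Id0_one:
  assumes "f \<in> Id0 G Rd" shows "f \<one> = 1"
proof -
  interpret E: comm_group "mult_group (roots_of_unity :: 'r set)" by (rule comm_group_roots)
  show ?thesis using hom_one[OF Id0_hom[OF assms] is_group E.is_group] by simp
qed

lemma Id0_inverse:
  assumes "f \<in> Id0 G Rd" "g \<in> carrier G" shows "f g * f (inv g) = 1"
  using Id0D(3)[OF assms(1), of g "inv g"] assms(2) Id0_one[OF assms(1)] by simp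

lemma Id0_image_unit_subgroup:
  assumes f: "f \<in> Id0 G Rd" shows "is_unit_subgroup (f ` carrier G)"
  unfolding is_unit_subgroup_def
proof (intro conjI ballI)
  show "1 \<in> f ` carrier G" using Id0_one[OF f] by (metis imageI one_closed)
  fix x assume "x \<in> f ` carrier G"
  then obtain a where a: "a \<in> carrier G" "x = f a" by blast
  show "\<exists>y\<in>f ` carrier G. x * y = 1" using Id0_inverse[OF f a(1)] a by (intro bexI[of _ "f (inv a)"]) auto
  fix y assume "y \<in> f ` carrier G"
  then obtain b where b: "b \<in> carrier G" "y = f b" by blast
  show "x * y \<in> f ` carrier G" using Id0D(3)[OF f a(1) b(1)] a b by (intro image_eqI[of _ _ "a \<otimes> b"]) auto
qed

lemma Id0_span_image:
  assumes f: "f \<in> Id0 G Rd" and z: "z \<in> f ` carrier G"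
  shows "graded_span Rd {g\<in>carrier G. f g = z} = (\<lambda>a. a * z) ` graded_span Rd {g\<in>carrier G. f g = 1}"
proof -
  \<comment> \<open>Here the identity f \<circ> d \<circ> f = f enters: it places every
    \<open>v\<close> in the image of \<open>f\<close> in the fibre over itself. Multiplication by
    \<open>z\<close> and by its inverse then move between the fibres over 1 and
    \<open>z\<close>.\<close>
  have self: "v \<in> graded_span Rd {g\<in>carrier G. f g = v}" if v: "v \<in> f ` carrier G" for v
  proof -
    have "v \<in> roots_of_unity" using v Id0_image_subset[OF f] by blast
    moreover have "f (d v) = v" using v Id0D(4)[OF f] by auto
    ultimately show ?thesis
      using supp_root_of_unity deg_in by (subst graded_span_iff) auto
  qed
  have mult: "x * y \<in> graded_span Rd {g\<in>carrier G. f g = a * b}"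
    if "x \<in> graded_span Rd {g\<in>carrier G. f g = a}" "y \<in> graded_span Rd {g\<in>carrier G. f g = b}"
      "a \<in> roots_of_unity" "b \<in> roots_of_unity" for a b x y
    using pushforward_mult[OF comm_group_roots Id0_hom[OF f], of a b x y] that by simp
  have zU: "z \<in> roots_of_unity" using z Id0_image_subset[OF f] by blast
  obtain v where v: "v \<in> f ` carrier G" "z * v = 1"
    using Id0_image_unit_subgroup[OF f] z unfolding is_unit_subgroup_def by blast
  have vU: "v \<in> roots_of_unity" using v(1) Id0_image_subset[OF f] by blast
  show ?thesis
  proof (intro equalityI subsetI)
    fix r assume "r \<in> graded_span Rd {g\<in>carrier G. f g = z}"
    then have "r * v \<in> graded_span Rd {g\<in>carrier G. f g = 1}"
      using mult[OF _ self[OF v(1)] zU vU, of r] v(2) by simp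
    moreover have "r = r * v * z" using v(2) by (simp add: mult.assoc mult.commute[of v z])
    ultimately show "r \<in> (\<lambda>a. a * z) ` graded_span Rd {g\<in>carrier G. f g = 1}" by blast
  next
    fix r assume "r \<in> (\<lambda>a. a * z) ` graded_span Rd {g\<in>carrier G. f g = 1}"
    then show "r \<in> graded_span Rd {g\<in>carrier G. f g = z}"
      using mult[OF _ self[OF z] roots_of_unity_1 zU] by auto
  qed
qed

lemma Id0_kernel_subring:
  assumes f: "f \<in> Id0 G Rd"
  shows "is_subring (graded_span Rd {g\<in>carrier G. f g = 1})"
proof -
  interpret P: graded_ring "mult_group (roots_of_unity :: 'r set)" "\<lambda>z. graded_span Rd {g\<in>carrier G. f g = z}"
    by (rule graded_ringI) (rule pushforward_grading[OF comm_group_roots Id0_hom[OF f]])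
  have one: "1 \<in> carrier (mult_group (roots_of_unity :: 'r set))" by (simp add: roots_of_unity_1)
  show ?thesis
    unfolding is_subring_def using P.one_in P.Rd_add[OF one] P.Rd_diff[OF one] P.Rd_mult[OF one one]
    by simp
qed

lemma Phi_in_DR:
  assumes f: "f \<in> Id0 G Rd" shows "Phi G Rd f \<in> DR TYPE('r)"
proof -
  let ?A = "graded_span Rd {g\<in>carrier G. f g = 1}" and ?H = "f ` carrier G"
  \<comment> \<open>The degree group is cut down to the image of \<open>f\<close>: fibres over other
    roots of unity are empty, so the pieces there are 0 and not translates of the kernel
    span.\<close>
  have "is_grading (mult_group ?H) (\<lambda>z. graded_span Rd {g\<in>carrier G. f g = z})"
    by (intro pushforward_grading comm_group_mult_group Id0_image_unit_subgroup[OF f] Id0_image_hom[OF f])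
  then have "is_grading (mult_group ?H) (\<lambda>z. (\<lambda>a. a * z) ` ?A)"
    by (rule is_grading_cong) (simp only: mult_group_simps Id0_span_image[OF f])
  then show ?thesis
    unfolding DR_def Phi_def
    using is_grading_mult_group_iff[OF Id0_kernel_subring[OF f] Id0_image_unit_subgroup[OF f]]
      Id0_kernel_subring[OF f] Id0_image_unit_subgroup[OF f] by simp
qed

text \<open>The kernel span and the image determine the span of every fibre as a translate. A
  nonzero homogeneous element lies over one value only, so \<open>f\<close> and \<open>h\<close>
  agree at every degree that occurs.\<close>

lemma Phi_inj: "inj_on (Phi G Rd) (Id0 G Rd)"
proof (rule inj_onI)
  fix f h assume f: "f \<in> Id0 G Rd" and h: "h \<in> Id0 G Rd" and eq: "Phi G Rd f = Phi G Rd h"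
  let ?H = "f ` carrier G"
  have A: "graded_span Rd {g\<in>carrier G. f g = 1} = graded_span Rd {g\<in>carrier G. h g = 1}"
    and H: "?H = h ` carrier G"
    using eq by (simp_all add: Phi_def)
  have "f g = h g" if "g \<in> carrier G" for g
  proof (rule hom_eq_on_support[OF comm_group_mult_group[OF Id0_image_unit_subgroup[OF f]] _ _ _ _ that])
    show "countable (carrier (mult_group ?H))" by (simp add: countable_order[OF order])
    show "f \<in> hom G (mult_group ?H)" by (rule Id0_image_hom[OF f])
    show "h \<in> hom G (mult_group ?H)" unfolding H by (rule Id0_image_hom[OF h])
    fix c x assume c: "c \<in> carrier G" "x \<in> Rd c" "x \<noteq> 0"
    have fc: "f c \<in> f ` carrier G" "f c \<in> h ` carrier G" using c(1) H by auto
    have supp: "supp x = {c}" using c by (auto simp: supp_def cmp_homogeneous split: if_splits)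
    have "x \<in> graded_span Rd {g\<in>carrier G. f g = f c}"
      using supp c(1) by (subst graded_span_iff) auto
    also have "\<dots> = graded_span Rd {g\<in>carrier G. h g = f c}"
      unfolding Id0_span_image[OF f fc(1)] Id0_span_image[OF h fc(2)] A ..
    finally have "supp x \<subseteq> {g\<in>carrier G. h g = f c}"
      by (subst (asm) graded_span_iff) auto
    then show "f c = h c" using supp by auto
  qed
  then show "f = h" using Id0D(2)[OF f] Id0D(2)[OF h] by (intro extensionalityI[of _ "carrier G"]) auto
qed

lemma Phi_surj:
  assumes AH: "(A, H) \<in> DR TYPE('r)"
  shows "\<exists>f\<in>Id0 G Rd. Phi G Rd f = (A, H)"
proof -
  have A: "is_subring A" and H: "is_unit_subgroup H" and iso: "group_ring_iso A H"
    using AH by (simp_all add: DR_def)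
  have gr: "is_grading (mult_group H) (\<lambda>h. (\<lambda>a. a * h) ` A)"
    using is_grading_mult_group_iff[OF A H] iso by simp
  interpret P: graded_ring "mult_group H" "\<lambda>h. (\<lambda>a. a * h) ` A" using gr by (rule graded_ringI)
  have one: "1 \<in> A" using A by (simp add: is_subring_def)
  have hne: "h \<noteq> 0" if h: "h \<in> H" for h
    using H h connected_nontrivial[OF connected] unfolding is_unit_subgroup_def by (metis mult_zero_left)
  have hin: "h \<in> (\<lambda>a. a * h) ` A" for h using one by (intro image_eqI[of _ _ 1]) simp_all
  \<comment> \<open>As 1 lies in \<open>A\<close>, each \<open>h\<close> in \<open>H\<close> is
    homogeneous of degree \<open>h\<close>; so the finite bound on supports in the
    \<open>H\<close>-grading contains \<open>H\<close>.\<close>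
  have fin: "finite H"
  proof -
    obtain W where W: "finite W" "\<And>r. P.supp r \<subseteq> W" using P.finite_support[OF order] by blast
    have "h \<in> P.supp h" if h: "h \<in> H" for h
      unfolding P.supp_def using P.cmp_homogeneous[of h h h] hin hne[OF h] h by simp
    then have "H \<subseteq> W" using W(2) by blast
    then show ?thesis using W(1) finite_subset by blast
  qed
  have HU: "H \<subseteq> roots_of_unity" by (rule finite_unit_subgroup_roots_of_unity[OF H fin])
  have cnt: "countable (carrier (mult_group H))" using fin by (simp add: countable_finite)
  obtain f where f: "f \<in> hom G (mult_group H)" "f \<in> extensional (carrier G)"
    and span: "\<And>h. h \<in> H \<Longrightarrow> (\<lambda>a. a * h) ` A = graded_span Rd {g\<in>carrier G. f g = h}"
    using ex1_implies_ex[OF universal_grading_countable[OF universal gr cnt]] unfolding mult_group_simps by blast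
  have fH: "f g \<in> H" if "g \<in> carrier G" for g using f(1) that by (auto simp: hom_def)
  \<comment> \<open>Because \<open>h\<close> lies in its own piece, which is the span of the fibre
    over \<open>h\<close>, and its support is its degree. This yields f \<circ> d \<circ> f = f and
    also that \<open>H\<close> is the full image.\<close>
  have fd: "f (d h) = h" if h: "h \<in> H" for h
  proof -
    have "h \<in> graded_span Rd {g\<in>carrier G. f g = h}" using hin span[OF h] by blast
    then have "supp h \<subseteq> {g\<in>carrier G. f g = h}" by (subst (asm) graded_span_iff) auto
    then show ?thesis using supp_root_of_unity[of h] h HU by auto
  qed
  have fI: "f \<in> Id0 G Rd"
    unfolding Id0_def using f fH fd HU by (auto simp: PiE_def hom_def)
  have "H \<subseteq> f ` carrier G"
  proof
    fix h assume h: "h \<in> H"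
    then have "d h \<in> carrier G" using HU deg_in(1) by blast
    then show "h \<in> f ` carrier G" using fd[OF h] by (metis imageI)
  qed
  then have "f ` carrier G = H" using fH by blast
  moreover have "1 \<in> H" using H by (simp add: is_unit_subgroup_def)
  then have "graded_span Rd {g\<in>carrier G. f g = 1} = A" using span[of 1] by simp
  ultimately have "Phi G Rd f = (A, H)" by (simp add: Phi_def)
  with fI show ?thesis by blast
qed

lemma Phi_bij: "bij_betw (Phi G Rd) (Id0 G Rd) (DR TYPE('r))"
proof (rule bij_betw_imageI[OF Phi_inj], intro equalityI subsetI)
  fix p assume "p \<in> Phi G Rd ` Id0 G Rd"
  then show "p \<in> DR TYPE('r)" using Phi_in_DR by blast
next
  fix p :: "'r set \<times> 'r set" assume p: "p \<in> DR TYPE('r)"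
  obtain A H where "p = (A, H)" by (cases p)
  with p Phi_surj[of A H] show "p \<in> Phi G Rd ` Id0 G Rd" by (metis imageI)
qed

text \<open>The two equations correspond to the two inclusions: h \<circ> d \<circ> f = f to that of
  the images, f \<circ> d \<circ> h = f to that of the kernel spans.\<close>

lemma Id0_le_iff:
  assumes f: "f \<in> Id0 G Rd" and h: "h \<in> Id0 G Rd"
  shows "Id0_le G Rd f h \<longleftrightarrow> DR_le (Phi G Rd f) (Phi G Rd h)"
proof
  assume le: "Id0_le G Rd f h"
  have fh: "f (d (h g)) = f g" "h (d (f g)) = f g" if "g \<in> carrier G" for g
    using le that unfolding Id0_le_def by blast+
  have "f ` carrier G \<subseteq> h ` carrier G"
  proof
    fix z assume "z \<in> f ` carrier G"
    then obtain g where g: "g \<in> carrier G" "z = f g" by blast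
    show "z \<in> h ` carrier G"
      unfolding g(2) using fh(2)[OF g(1), symmetric] deg_in(1)[OF Id0D(1)[OF f g(1)]] by (rule image_eqI)
  qed
  moreover have "{g\<in>carrier G. h g = 1} \<subseteq> {g\<in>carrier G. f g = 1}"
  proof
    fix g assume g: "g \<in> {g\<in>carrier G. h g = 1}"
    then have "g \<in> carrier G" "h g = 1" by auto
    then have "f g = f (d 1)" using fh(1)[of g] by (simp only:)
    also have "\<dots> = 1" unfolding deg_one by (rule Id0_one[OF f])
    finally show "g \<in> {g\<in>carrier G. f g = 1}" using \<open>g \<in> carrier G\<close> by blast
  qed
  then have "graded_span Rd {g\<in>carrier G. h g = 1} \<subseteq> graded_span Rd {g\<in>carrier G. f g = 1}"
    unfolding graded_span_def by blast
  ultimately show "DR_le (Phi G Rd f) (Phi G Rd h)" by (simp add: DR_le_def Phi_def)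
next
  assume "DR_le (Phi G Rd f) (Phi G Rd h)"
  then have im: "f ` carrier G \<subseteq> h ` carrier G"
    and ker: "graded_span Rd {g\<in>carrier G. h g = 1} \<subseteq> graded_span Rd {g\<in>carrier G. f g = 1}"
    by (simp_all add: DR_le_def Phi_def)
  have "h (d (f g)) = f g" if g: "g \<in> carrier G" for g
  proof -
    have "f g \<in> h ` carrier G" using im imageI[OF g, of f] by (rule subsetD)
    then obtain g' where "f g = h g'" "g' \<in> carrier G" by (rule imageE)
    then show ?thesis using Id0D(4)[OF h, of g'] by (simp only:)
  qed
  moreover have "f (d (h g)) = f g" if "g \<in> carrier G" for g
  proof -
    have dh: "d (h c) \<in> carrier G" if "c \<in> carrier G" for c using deg_in(1)[OF Id0D(1)[OF h that]] .
    \<comment> \<open>An inclusion of spans is silent about kernel degrees whose piece is 0, so both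
      homomorphisms are compared on the support only.\<close>
    show ?thesis
    proof (rule hom_eq_on_support[OF comm_group_roots _ _ Id0_hom[OF f] _ that])
      show "countable (carrier (mult_group (roots_of_unity :: 'r set)))" by (simp add: countable_order[OF order])
      show "(\<lambda>c. f (d (h c))) \<in> hom G (mult_group roots_of_unity)"
      proof (rule homI)
        fix a b assume ab: "a \<in> carrier G" "b \<in> carrier G"
        have "f (d (h (a \<otimes> b))) = f (d (h a) \<otimes> d (h b))"
          by (simp only: Id0D(3)[OF h ab] deg_mult[OF Id0D(1)[OF h ab(1)] Id0D(1)[OF h ab(2)]])
        also have "\<dots> = f (d (h a)) * f (d (h b))" by (rule Id0D(3)[OF f dh[OF ab(1)] dh[OF ab(2)]])
        finally show "f (d (h (a \<otimes> b))) = f (d (h a)) \<otimes>\<^bsub>mult_group roots_of_unity\<^esub> f (d (h b))"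
          by simp
      qed (simp add: Id0D(1)[OF f dh])
      fix c x assume c: "c \<in> carrier G" "x \<in> Rd c" "x \<noteq> 0"
      \<comment> \<open>Multiplication by \<open>?v\<close>, the inverse of \<open>h c\<close>,
        moves \<open>x\<close> into the kernel span of \<open>h\<close> and so into that of
        \<open>f\<close>. The degree of the product shows that \<open>f c\<close> is inverse to
        \<open>f (d ?v)\<close>, as \<open>f (d (h c))\<close> is too.\<close>
      let ?v = "h (inv c)"
      have vU: "?v \<in> roots_of_unity" using Id0D(1)[OF h] c(1) by simp
      have v: "h c * ?v = 1" by (rule Id0_inverse[OF h c(1)])
      let ?e = "c \<otimes> d ?v"
      have e: "?e \<in> carrier G" using c(1) deg_in(1)[OF vU] by simp
      have "x * ?v \<noteq> 0"
      proof
        assume "x * ?v = 0"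
        then have "x * (h c * ?v) = 0" by (simp only: mult.left_commute[of x] mult_zero_right)
        then show False using c(3) by (simp only: v mult_1_right)
      qed
      moreover have xv: "x * ?v \<in> Rd ?e" using Rd_mult[OF c(1) deg_in(1)[OF vU] c(2) deg_in(2)[OF vU]] .
      ultimately have supp: "supp (x * ?v) = {?e}"
        using e by (auto simp: supp_def cmp_homogeneous split: if_splits)
      have "h ?e = 1"
        using Id0D(3)[OF h c(1) deg_in(1)[OF vU]] Id0D(4)[OF h, of "inv c"] c(1) v by simp
      then have "x * ?v \<in> graded_span Rd {g\<in>carrier G. h g = 1}"
        using supp e by (subst graded_span_iff) auto
      then have "x * ?v \<in> graded_span Rd {g\<in>carrier G. f g = 1}" using ker by blast
      then have "supp (x * ?v) \<subseteq> {g\<in>carrier G. f g = 1}" by (subst (asm) graded_span_iff) auto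
      then have "f ?e = 1" using supp by simp
      then have 1: "f c * f (d ?v) = 1" using Id0D(3)[OF f c(1) deg_in(1)[OF vU]] by simp
      have "f (d (h c)) * f (d ?v) = f (d (h c) \<otimes> d ?v)"
        using Id0D(3)[OF f dh[OF c(1)] deg_in(1)[OF vU]] by simp
      also have "d (h c) \<otimes> d ?v = \<one>"
        using deg_mult[OF Id0D(1)[OF h c(1)] vU] v deg_one by simp
      finally have 2: "f (d (h c)) * f (d ?v) = 1" using Id0_one[OF f] by simp
      have "f (d (h c)) = f (d (h c)) * (f c * f (d ?v))" using 1 by simp
      also have "\<dots> = f c * (f (d (h c)) * f (d ?v))" by (rule mult.left_commute)
      finally show "f (d (h c)) = f c" using 2 by simp
    qed
  qed
  ultimately show "Id0_le G Rd f h" by (simp add: Id0_le_def)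
qed

text \<open>Conjugation moves the kernel by \<open>h\<close> and the image by \<open>s\<close>, and
  \<open>s\<close> carries the span of a set of degrees onto the span of its image under
  \<open>h\<close>.\<close>

lemma aut_action:
  assumes s: "ring_aut s" and ind: "induced_aut G Rd s h" and f: "f \<in> Id0 G Rd"
  shows "act_Id0 G s h f \<in> Id0 G Rd" "Phi G Rd (act_Id0 G s h f) = act_DR s (Phi G Rd f)"
proof -
  let ?k = "inv_into (carrier G) h" and ?f = "act_Id0 G s h f"
  have bij: "bij_betw h (carrier G) (carrier G)" and hom: "h \<in> hom G G"
    using ind by (auto simp: induced_aut_def iso_def)
  have hG: "h c \<in> carrier G" if "c \<in> carrier G" for c using bij that by (auto simp: bij_betw_def)
  have kh: "?k (h c) = c" if "c \<in> carrier G" for c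
    using bij_betw_inv_into_left[OF bij that] .
  have hk: "h (?k c) = c" "?k c \<in> carrier G" if "c \<in> carrier G" for c
    using bij_betw_inv_into_right[OF bij that] bij_betw_inv_into[OF bij] that by (auto simp: bij_betw_def)
  have k_mult: "?k (a \<otimes> b) = ?k a \<otimes> ?k b" if ab: "a \<in> carrier G" "b \<in> carrier G" for a b
  proof -
    have "h (?k a \<otimes> ?k b) = a \<otimes> b" using hom_mult[OF hom hk(2)[OF ab(1)] hk(2)[OF ab(2)]] hk(1) ab by simp
    then show ?thesis using kh[of "?k a \<otimes> ?k b"] hk(2) ab by simp
  qed
  have s_add: "s (x + y) = s x + s y" and s_mult: "s (x * y) = s x * s y" and s1: "s 1 = 1" for x y
    using s by (auto simp: ring_aut_def)
  have s0: "s 0 = 0" using s_add[of 0 0] by simp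
  have s_inj: "s x = s y \<longleftrightarrow> x = y" for x y using s by (auto simp: ring_aut_def bij_def inj_eq)
  have s_pow: "s (x ^ k) = s x ^ k" for x and k :: nat by (induction k) (simp_all add: s1 s_mult)
  have s_sum: "s (\<Sum>i\<in>I. x i) = (\<Sum>i\<in>I. s (x i))" for I :: "'g set" and x
    by (induction I rule: infinite_finite_induct) (simp_all add: s0 s_add)
  have sU: "s z \<in> roots_of_unity" if "z \<in> roots_of_unity" for z
    using that unfolding roots_of_unity_def by (auto simp: s_pow[symmetric] s1)
  have sRd: "s ` Rd c = Rd (h c)" if "c \<in> carrier G" for c
    using ind that by (simp add: induced_aut_def)
  \<comment> \<open>Equivariance of the degree map; it is what carries f \<circ> d \<circ> f = f
    over to the conjugate.\<close>
  have ds: "d (s z) = h (d z)" if z: "z \<in> roots_of_unity" for z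
    using deg_in[OF z] sRd hG root_of_unity_not_zero[OF sU[OF z]] by (intro deg_eqI) auto
  have f_eq: "?f c = s (f (?k c))" if "c \<in> carrier G" for c
    using that by (simp add: act_Id0_def)
  show "?f \<in> Id0 G Rd"
    unfolding Id0_def
  proof (intro CollectI conjI ballI)
    have "?f c \<in> roots_of_unity" if "c \<in> carrier G" for c
      using f_eq[OF that] sU[OF Id0D(1)[OF f hk(2)[OF that]]] by simp
    moreover have "?f \<in> extensional (carrier G)" by (simp add: act_Id0_def)
    ultimately show "?f \<in> carrier G \<rightarrow>\<^sub>E roots_of_unity" by (auto simp: PiE_def)
    fix a assume a: "a \<in> carrier G"
    show "?f (a \<otimes> b) = ?f a * ?f b" if b: "b \<in> carrier G" for b
      using a b f_eq k_mult Id0D(3)[OF f] hk(2) by (simp add: s_mult)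
    have U: "f (?k a) \<in> roots_of_unity" using Id0D(1)[OF f] hk(2) a by blast
    have "?f (d (?f a)) = ?f (h (d (f (?k a))))" using f_eq[OF a] ds[OF U] by simp
    also have "\<dots> = s (f (d (f (?k a))))" using f_eq kh hG deg_in(1)[OF U] by simp
    also have "\<dots> = ?f a" using Id0D(4)[OF f hk(2)[OF a]] f_eq[OF a] by simp
    finally show "?f (d (?f a)) = ?f a" .
  qed
  have im: "?f ` carrier G = s ` f ` carrier G"
  proof -
    have "?f ` carrier G = (\<lambda>c. s (f c)) ` ?k ` carrier G"
      using f_eq by (auto simp: image_image)
    also have "?k ` carrier G = carrier G"
      using bij_betw_inv_into[OF bij] by (simp add: bij_betw_def)
    finally show ?thesis by (simp add: image_image)
  qed
  have sub: "s ` graded_span Rd K \<subseteq> graded_span Rd (h ` K)" if K: "K \<subseteq> carrier G" for K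
  proof
    fix t assume "t \<in> s ` graded_span Rd K"
    then obtain T x where T: "finite T" "T \<subseteq> K" "\<forall>g\<in>T. x g \<in> Rd g" "t = s (\<Sum>g\<in>T. x g)"
      unfolding graded_span_def by blast
    have TG: "T \<subseteq> carrier G" using T(2) K by blast
    have "t = (\<Sum>g\<in>T. s (x (?k (h g))))"
      unfolding T(4) s_sum using TG kh by (intro sum.cong) auto
    also have "\<dots> = (\<Sum>c\<in>h ` T. s (x (?k c)))"
      using bij TG by (subst sum.reindex) (auto simp: bij_betw_def inj_on_subset)
    finally have "t = (\<Sum>c\<in>h ` T. s (x (?k c)))" .
    moreover have "\<forall>c\<in>h ` T. s (x (?k c)) \<in> Rd c"
    proof
      fix c assume "c \<in> h ` T"
      then obtain g where g: "c = h g" "g \<in> T" by (rule imageE)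
      have gG: "g \<in> carrier G" using g(2) TG by blast
      have "s (x g) \<in> Rd (h g)" using T(3) g(2) sRd[OF gG] by blast
      then show "s (x (?k c)) \<in> Rd c" unfolding g(1) kh[OF gG] .
    qed
    ultimately show "t \<in> graded_span Rd (h ` K)"
      unfolding graded_span_def using T(1,2)
      by (intro CollectI exI[of _ "h ` T"] exI[of _ "\<lambda>c. s (x (?k c))"]) auto
  qed
  have sup: "graded_span Rd (h ` K) \<subseteq> s ` graded_span Rd K" if K: "K \<subseteq> carrier G" for K
  proof
    fix t assume "t \<in> graded_span Rd (h ` K)"
    then obtain T x where T: "finite T" "T \<subseteq> h ` K" "\<forall>g\<in>T. x g \<in> Rd g" "t = (\<Sum>g\<in>T. x g)"
      unfolding graded_span_def by blast
    have TG: "T \<subseteq> carrier G" using T(2) K hG by blast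
    have "\<exists>y\<in>Rd (?k c). s y = x c" if "c \<in> T" for c
    proof -
      have cG: "c \<in> carrier G" using that TG by blast
      have "x c \<in> s ` Rd (?k c)"
        unfolding sRd[OF hk(2)[OF cG]] hk(1)[OF cG] using T(3) that by blast
      then show ?thesis by (rule imageE) (intro bexI, rule sym)
    qed
    then have "\<forall>c\<in>T. \<exists>y. y \<in> Rd (?k c) \<and> s y = x c" by blast
    from bchoice[OF this] obtain y where y: "\<forall>c\<in>T. y c \<in> Rd (?k c) \<and> s (y c) = x c" ..
    have "(\<Sum>c\<in>T. y c) = (\<Sum>c\<in>T. y (h (?k c)))"
      using TG hk(1) by (intro sum.cong) auto
    also have "\<dots> = (\<Sum>g\<in>?k ` T. y (h g))"
      using bij_betw_inv_into[OF bij] TG by (subst sum.reindex) (auto simp: bij_betw_def inj_on_subset)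
    finally have "(\<Sum>c\<in>T. y c) = (\<Sum>g\<in>?k ` T. y (h g))" .
    moreover have "?k ` T \<subseteq> K"
    proof
      fix g assume "g \<in> ?k ` T"
      then obtain c where c: "g = ?k c" "c \<in> T" by (rule imageE)
      then obtain a where a: "c = h a" "a \<in> K" using T(2) by blast
      have "a \<in> carrier G" using a(2) K by blast
      then show "g \<in> K" unfolding c(1) a(1) using a(2) by (simp only: kh)
    qed
    moreover have "\<forall>g\<in>?k ` T. y (h g) \<in> Rd g"
    proof
      fix g assume "g \<in> ?k ` T"
      then obtain c where c: "g = ?k c" "c \<in> T" by (rule imageE)
      have cG: "c \<in> carrier G" using c(2) TG by blast
      show "y (h g) \<in> Rd g" unfolding c(1) hk(1)[OF cG] using y c(2) by blast
    qed
    ultimately have "(\<Sum>c\<in>T. y c) \<in> graded_span Rd K"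
      unfolding graded_span_def using T(1)
      by (intro CollectI exI[of _ "?k ` T"] exI[of _ "\<lambda>g. y (h g)"]) auto
    moreover have "t = s (\<Sum>c\<in>T. y c)" unfolding T(4) s_sum using y by (intro sum.cong) auto
    ultimately show "t \<in> s ` graded_span Rd K" by blast
  qed
  have "{g\<in>carrier G. ?f g = 1} = h ` {g\<in>carrier G. f g = 1}"
  proof (intro equalityI subsetI)
    fix c assume "c \<in> {g\<in>carrier G. ?f g = 1}"
    then have c: "c \<in> carrier G" "?f c = 1" by auto
    then have "s (f (?k c)) = s 1" using f_eq s1 by simp
    then have "f (?k c) = 1" by (simp add: s_inj)
    then show "c \<in> h ` {g\<in>carrier G. f g = 1}"
      using hk[OF c(1)] by (intro image_eqI[of _ _ "?k c"]) auto
  next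
    fix c assume "c \<in> h ` {g\<in>carrier G. f g = 1}"
    then show "c \<in> {g\<in>carrier G. ?f g = 1}" using f_eq hG kh s1 by auto
  qed
  then have "graded_span Rd {g\<in>carrier G. ?f g = 1} = s ` graded_span Rd {g\<in>carrier G. f g = 1}"
    using sub[of "{g\<in>carrier G. f g = 1}"] sup[of "{g\<in>carrier G. f g = 1}"] by auto
  then show "Phi G Rd ?f = act_DR s (Phi G Rd f)"
    using im by (simp add: Phi_def act_DR_def)
qed

text \<open>\<open>A\<close> consists of the elements supported in the kernel, so its nonzero
  homogeneous elements have exactly the kernel degrees that occur in R. That these generate the
  whole kernel is a consequence of \<open>carrier_decomposition\<close>.\<close>

lemma GammaA_kernel:
  assumes f: "f \<in> Id0 G Rd"
  defines "A \<equiv> graded_span Rd {g\<in>carrier G. f g = 1}"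
  shows "\<And>g. g \<in> GammaA G Rd A \<Longrightarrow> g \<in> carrier G \<and> f g = 1" "subgroup (GammaA G Rd A) G"
    "\<And>g x. g \<in> carrier G \<Longrightarrow> f g = 1 \<Longrightarrow> x \<in> Rd g \<Longrightarrow> x \<noteq> 0 \<Longrightarrow> g \<in> GammaA G Rd A"
proof -
  let ?S = "{g\<in>carrier G. \<exists>x\<in>Rd g \<inter> A. x \<noteq> 0}"
  show sub: "subgroup (GammaA G Rd A) G"
    unfolding GammaA_def by (rule generate_is_subgroup) auto
  have S: "f g = 1" if g: "g \<in> ?S" for g
  proof -
    obtain x where x: "g \<in> carrier G" "x \<in> Rd g" "x \<in> A" "x \<noteq> 0" using g by blast
    have "supp x \<subseteq> {g\<in>carrier G. f g = 1}"
      using x(3) unfolding A_def by (subst (asm) graded_span_iff) auto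
    moreover have "g \<in> supp x" using x by (simp add: supp_def cmp_homogeneous)
    ultimately show ?thesis by blast
  qed
  have "f g = 1" if "g \<in> generate G ?S" for g
    using that
  proof (induction g rule: generate.induct)
    case one
    show ?case by (rule Id0_one[OF f])
  next
    case (incl g)
    then show ?case by (rule S)
  next
    case (inv g)
    then show ?case using Id0_inverse[OF f, of g] S[OF inv] by auto
  next
    case (eng a b)
    have "a \<in> carrier G" "b \<in> carrier G"
      using eng generate_incl[of ?S] by blast+
    then show ?case using Id0D(3)[OF f] eng by simp
  qed
  then show "g \<in> carrier G \<and> f g = 1" if "g \<in> GammaA G Rd A" for g
    using that subgroup.subset[OF sub] unfolding GammaA_def by blast
  show "g \<in> GammaA G Rd A" if g: "g \<in> carrier G" "f g = 1" "x \<in> Rd g" "x \<noteq> 0" for g x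
  proof -
    have "supp x = {g}" using g by (auto simp: supp_def cmp_homogeneous split: if_splits)
    then have "x \<in> A" unfolding A_def using g by (subst graded_span_iff) auto
    then show ?thesis unfolding GammaA_def using g by (intro generate.incl) auto
  qed
qed

text \<open>The map \<open>\<phi>\<close> is the projection complementary to the idempotent
  endomorphism d \<circ> f of the group. It clearly maps to the kernel of \<open>f\<close>; to see
  that it maps to the possibly smaller generated subgroup, it suffices to look at the degrees that
  occur, as they generate the group.\<close>

lemma carrier_decomposition:
  assumes f: "f \<in> Id0 G Rd" and g: "g \<in> carrier G"
  defines "A \<equiv> graded_span Rd {g\<in>carrier G. f g = 1}"
  shows "\<exists>a\<in>GammaA G Rd A. \<exists>b\<in>d ` f ` carrier G. g = a \<otimes> b"
proof -
  note GA = GammaA_kernel[OF f, folded A_def]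
  have dG: "d (f c) \<in> carrier G" if "c \<in> carrier G" for c using deg_in(1)[OF Id0D(1)[OF f that]] .
  let ?S = "{g\<in>carrier G. \<exists>x\<in>Rd g. x \<noteq> 0}"
  define \<phi> where "\<phi> c = c \<otimes> inv (d (f c))" for c
  have base: "\<phi> c \<in> GammaA G Rd A" if cS: "c \<in> ?S" for c
  proof -
    obtain x where c: "c \<in> carrier G" "x \<in> Rd c" "x \<noteq> 0" using cS by blast
    \<comment> \<open>\<open>\<phi> c\<close> is the degree of \<open>x * ?v\<close>, which is
      nonzero because \<open>?v\<close> is a unit; so it is a kernel degree that occurs in
      R.\<close>
    let ?v = "f (inv c)"
    have vU: "?v \<in> roots_of_unity" using Id0D(1)[OF f] c(1) by simp
    have v: "f c * ?v = 1" by (rule Id0_inverse[OF f c(1)])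
    have "d (f c) \<otimes> d ?v = \<one>"
      using deg_mult[OF Id0D(1)[OF f c(1)] vU] v deg_one by simp
    then have inv: "inv (d (f c)) = d ?v"
      using dG[OF c(1)] deg_in(1)[OF vU] by (metis inv_equality m_comm)
    have "x * ?v \<noteq> 0"
    proof
      assume "x * ?v = 0"
      then have "x * (f c * ?v) = 0" by (simp only: mult.left_commute[of x] mult_zero_right)
      then show False using c(3) by (simp only: v mult_1_right)
    qed
    moreover have "x * ?v \<in> Rd (c \<otimes> d ?v)" using Rd_mult[OF c(1) deg_in(1)[OF vU] c(2) deg_in(2)[OF vU]] .
    moreover have "f (c \<otimes> d ?v) = 1"
      using Id0D(3)[OF f c(1) deg_in(1)[OF vU]] Id0D(4)[OF f, of "inv c"] c(1) v by simp
    ultimately show ?thesis unfolding \<phi>_def inv using c(1) deg_in(1)[OF vU] by (intro GA(3)) auto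
  qed
  have \<phi>G: "\<phi> c \<in> carrier G" if "c \<in> carrier G" for c
    using that dG by (simp add: \<phi>_def)
  have \<phi>_mult: "\<phi> (a \<otimes> b) = \<phi> a \<otimes> \<phi> b" if ab: "a \<in> carrier G" "b \<in> carrier G" for a b
    using ab dG deg_mult[OF Id0D(1)[OF f ab(1)] Id0D(1)[OF f ab(2)]]
    by (simp add: \<phi>_def Id0D(3)[OF f] inv_mult m_ac)
  have \<phi>_one: "\<phi> \<one> = \<one>" by (simp add: \<phi>_def Id0_one[OF f] deg_one)
  have "\<phi> g \<in> GammaA G Rd A" if "g \<in> generate G ?S" for g
    using that
  proof (induction g rule: generate.induct)
    case one
    show ?case using \<phi>_one subgroup.one_closed[OF GA(2)] by simp
  next
    case (incl c)
    then show ?case by (rule base)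
  next
    case (inv c)
    then have c: "c \<in> carrier G" by blast
    have "\<phi> (inv c) \<otimes> \<phi> c = \<one>" using \<phi>_mult[of "inv c" c] c \<phi>_one by simp
    then have "\<phi> (inv c) = inv (\<phi> c)" using \<phi>G c by (intro inv_equality[symmetric]) auto
    then show ?case using subgroup.m_inv_closed[OF GA(2) base[OF inv]] by simp
  next
    case (eng a b)
    have "a \<in> carrier G" "b \<in> carrier G"
      using eng(1,2) generate_incl[of ?S] by blast+
    then show ?case using \<phi>_mult subgroup.m_closed[OF GA(2) eng(3,4)] by simp
  qed
  then have a: "g \<otimes> inv (d (f g)) \<in> GammaA G Rd A" using g generate_support unfolding \<phi>_def by blast
  show ?thesis
    using a g dG[OF g] by (intro bexI[OF _ a] bexI[of _ "d (f g)"]) (auto simp: m_assoc)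
qed

end

theorem theorem6p7:
  fixes G :: "'g monoid" and Rd :: "'g \<Rightarrow> 'r::comm_ring_1 set"
  assumes "is_order TYPE('r)" and "is_reduced TYPE('r)" and "is_connected TYPE('r)"
    and "universal_grading G Rd"
  shows "Phi G Rd \<in> Id0 G Rd \<rightarrow> DR TYPE('r)
    \<and> bij_betw (Phi G Rd) (Id0 G Rd) (DR TYPE('r))
    \<and> (\<forall>f\<in>Id0 G Rd. \<forall>h\<in>Id0 G Rd. Id0_le G Rd f h \<longleftrightarrow> DR_le (Phi G Rd f) (Phi G Rd h))
    \<and> (\<forall>s h. ring_aut s \<and> induced_aut G Rd s h \<longrightarrow>
          (\<forall>f\<in>Id0 G Rd. act_Id0 G s h f \<in> Id0 G Rd
              \<and> Phi G Rd (act_Id0 G s h f) = act_DR s (Phi G Rd f)))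
    \<and> (\<forall>A H. (A, H) \<in> DR TYPE('r) \<longrightarrow>
          (let f = inv_into (Id0 G Rd) (Phi G Rd) (A, H) in
             GammaA G Rd A \<inter> deg G Rd ` H = {\<one>\<^bsub>G\<^esub>}
           \<and> (\<forall>g\<in>carrier G. \<exists>a\<in>GammaA G Rd A. \<exists>b\<in>deg G Rd ` H. g = a \<otimes>\<^bsub>G\<^esub> b)
           \<and> H \<subseteq> roots_of_unity \<and> inj_on (deg G Rd) H
           \<and> (\<forall>g\<in>GammaA G Rd A. f g = 1)
           \<and> (\<forall>z\<in>H. f (deg G Rd z) = z)))"
proof -
  interpret universally_graded_order G Rd using assms by unfold_locales
  show ?thesis
  proof (intro conjI allI impI ballI)
    show "Phi G Rd \<in> Id0 G Rd \<rightarrow> DR TYPE('r)" using Phi_in_DR by blast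
    show "bij_betw (Phi G Rd) (Id0 G Rd) (DR TYPE('r))" by (rule Phi_bij)
  next
    fix f h assume "f \<in> Id0 G Rd" "h \<in> Id0 G Rd"
    then show "Id0_le G Rd f h \<longleftrightarrow> DR_le (Phi G Rd f) (Phi G Rd h)" by (rule Id0_le_iff)
  next
    fix s h f assume "ring_aut s \<and> induced_aut G Rd s h" "f \<in> Id0 G Rd"
    then show "act_Id0 G s h f \<in> Id0 G Rd" "Phi G Rd (act_Id0 G s h f) = act_DR s (Phi G Rd f)"
      using aut_action by blast+
  next
    fix A H :: "'r set" assume AH: "(A, H) \<in> DR TYPE('r)"
    define f where "f = inv_into (Id0 G Rd) (Phi G Rd) (A, H)"
    have f: "f \<in> Id0 G Rd"
      unfolding f_def using AH Phi_bij by (intro inv_into_into) (simp add: bij_betw_def)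
    have "Phi G Rd f = (A, H)"
      unfolding f_def using AH Phi_bij by (intro f_inv_into_f[where f = "Phi G Rd"]) (simp add: bij_betw_def)
    then have A: "A = graded_span Rd {g\<in>carrier G. f g = 1}" and H: "H = f ` carrier G"
      by (simp_all add: Phi_def)
    note GA = GammaA_kernel[OF f, folded A]
    have HU: "H \<subseteq> roots_of_unity" unfolding H by (rule Id0_image_subset[OF f])
    have fd: "f (deg G Rd z) = z" if "z \<in> H" for z
      using that Id0D(4)[OF f] unfolding H by auto
    have "1 \<in> H" unfolding H using Id0_one[OF f] by (metis imageI one_closed)
    then have "\<one>\<^bsub>G\<^esub> \<in> GammaA G Rd A \<inter> deg G Rd ` H"
      using subgroup.one_closed[OF GA(2)] deg_one by (metis IntI imageI)
    moreover have "g = \<one>\<^bsub>G\<^esub>" if g: "g \<in> GammaA G Rd A \<inter> deg G Rd ` H" for g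
    proof -
      obtain z where "z \<in> H" "g = deg G Rd z" using g by blast
      \<comment> \<open>On the one hand \<open>f\<close> is trivial on the subgroup attached to
        \<open>A\<close>, on the other it returns \<open>z\<close> from the degree of
        \<open>z\<close>.\<close>
      moreover from this have "z = 1" using GA(1)[of g] g fd[of z] by auto
      ultimately show ?thesis using deg_one by simp
    qed
    ultimately have int: "GammaA G Rd A \<inter> deg G Rd ` H = {\<one>\<^bsub>G\<^esub>}" by blast
    have "inj_on (deg G Rd) H" using fd by (rule inj_on_inverseI)
    then show "let f = inv_into (Id0 G Rd) (Phi G Rd) (A, H) in
             GammaA G Rd A \<inter> deg G Rd ` H = {\<one>\<^bsub>G\<^esub>}
           \<and> (\<forall>g\<in>carrier G. \<exists>a\<in>GammaA G Rd A. \<exists>b\<in>deg G Rd ` H. g = a \<otimes>\<^bsub>G\<^esub> b)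
           \<and> H \<subseteq> roots_of_unity \<and> inj_on (deg G Rd) H
           \<and> (\<forall>g\<in>GammaA G Rd A. f g = 1)
           \<and> (\<forall>z\<in>H. f (deg G Rd z) = z)"
      unfolding Let_def f_def[symmetric]
      using int HU fd GA(1) carrier_decomposition[OF f, folded A H] by blast
  qed
qed

end
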